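(* Let $n\ge1$ be fixed. For $d>0$ let $\gamma^{(d)}=(\gamma_k^{(d)})_{k\in\mathbb{N}}$ and $\delta^{(d)}=(\delta_k^{(d)})_{k\in\mathbb{N}}$ be real parameter sequences with $\gamma^{(d)}_k,\delta^{(d)}_k>-1$, and let $f_n^{(\gamma^{(d)},\delta^{(d)})}$ denote the density on the moment space $\mathcal{M}_n([0,d])$ given by $$f_n^{(\gamma^{(d)},\delta^{(d)})}(\mathbf{m}_n)=c_n^{[0,d]}\prod_{k=1}^n\Big(\frac{m_k-m_k^-}{m_k^+-m_k^-}\Big)^{\gamma_k^{(d)}}\Big(\frac{m_k^+-m_k}{m_k^+-m_k^-}\Big)^{\delta_k^{(d)}}\mathbf{1}_{\{m_k^-<m_k<m_k^+\}},$$ where $m_k^\pm$ are the bounds for the interval $[0,d]$ and $$c_n^{[0,d]}=\Big[d^{\,n(n+1)/2}\prod_{k=1}^n\int_0^1x^{n-k+\gamma_k^{(d)}}(1-x)^{n-k+\delta_k^{(d)}}\,dx\Big]^{-1}.$$ Suppose that for all $k\ge1$ $$\gamma_k^{(d)}\to\gamma_k>-1\qquad\text{and}\qquad \frac{\delta_k^{(d)}}{d}\to\delta_k>0\qquad\text{as }d\to\infty .$$ Then, as $d\to\infty$, the density $f_n^{(\gamma^{(d)},\delta^{(d)})}$ converges pointwise to the function $$g_n^{(\gamma,\delta)}(\mathbf{m}_n)=c_n^{[0,\infty)}\prod_{k=1}^n z_k(\mathbf{m}_n)^{\gamma_k}\exp\big(-\delta_kz_k(\mathbf{m}_n)\big)\mathbf{1}_{\{z_k(\mathbf{m}_n)>0\}},$$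 where $$c_n^{[0,\infty)}=\prod_{k=1}^n\frac{\delta_k^{\gamma_k+n-k+1}}{\Gamma(\gamma_k+n-k+1)}.$$ Moreover, $g_n^{(\gamma,\delta)}$ defines a (probability) density on the unbounded moment space $\mathcal{M}_n([0,\infty))$.
   Context: For $T\subset\mathbb{R}$, $\mathcal{P}(T)$ is the set of probability measures on the Borel field of $T$ with all moments existing, $m_k(\mu)=\int_Tx^k\,\mu(dx)$, and $\mathcal{M}_n(T)=\{(m_1(\mu),\dots,m_n(\mu))^T:\mu\in\mathcal{P}(T)\}\subset\mathbb{R}^n$. Densities are with respect to Lebesgue measure on $\mathbb{R}^n$ and vanish outside the interior of the respective moment space. For $T=[0,d]$ and $(m_1,\dots,m_{k-1})\in\mathcal{M}_{k-1}([0,d])$, $m_k^-$ and $m_k^+$ are the minimum and maximum of $m_k(\mu)$ over all $\mu\in\mathcal{P}([0,d])$ with $m_i(\mu)=m_i$, $i=1,\dots,k-1$. A point $\mathbf{m}_n=(m_1,\dots,m_n)^T$ is in the interior of $\mathcal{M}_n([0,d])$ iff $m_k^-<m_k<m_k^+$ for all $k=1,\dots,n$. For $T=[0,\infty)$ and $(m_1,\dots,m_{k-1})$ in the interior of $\mathcal{M}_{k-1}([0,\infty))$, $m_k^-$ is the minimum of $m_k(\mu)$ over all $\mu\in\mathcal{P}([0,\infty))$ with $m_i(\mu)=m_i$, $i=1,\dots,k-1$; the point $(m_1,\dots,m_n)^T$ is in the interior of $\mathcal{M}_n([0,\infty))$ iff $m_k>m_k^-$ for all $k=1,\dots,n$.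 For such a point, with this lower bound for $[0,\infty)$, $$z_k(\mathbf{m}_n)=\frac{m_k-m_k^-}{m_{k-1}-m_{k-1}^-},\qquad k=1,\dots,n,\qquad m_0=1,\ m_0^-=0 .$$ The indicator $\mathbf 1_{\{z_k(\mathbf m_n)>0\}}$ for all $k$ expresses that $\mathbf{m}_n$ lies in the interior of $\mathcal{M}_n([0,\infty))$. *)

theory Defs
  imports "HOL-Probability.Probability"
begin

text \<open>Points of \<open>n\<close>-dimensional space are functions \<^typ>\<open>nat \<Rightarrow> real\<close> that are extensional on the index
  set \<open>{1..n}\<close>, so that the dimension can vary with \<open>n\<close> and coordinates are numbered from 1.\<close>

abbreviation lebesgue_n :: "nat \<Rightarrow> (nat \<Rightarrow> real) measure" where
  "lebesgue_n n \<equiv> Pi\<^sub>M {1..n} (\<lambda>_. lborel)"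

abbreviation euclidean_n :: "nat \<Rightarrow> (nat \<Rightarrow> real) topology" where
  "euclidean_n n \<equiv> product_topology (\<lambda>_. euclideanreal) {1..n}"

definition moment_measures :: "real set \<Rightarrow> real measure set" where
  "moment_measures T =
     {M. prob_space M \<and> sets M = sets (restrict_space borel T) \<and> (\<forall>k. integrable M (\<lambda>x. x ^ k))}"

definition moment :: "real measure \<Rightarrow> nat \<Rightarrow> real" where
  "moment M k = (\<integral>x. x ^ k \<partial>M)"

definition moment_space :: "nat \<Rightarrow> real set \<Rightarrow> (nat \<Rightarrow> real) set" where
  "moment_space n T = {\<lambda>k\<in>{1..n}. moment M k | M. M \<in> moment_measures T}"

text \<open>The possible \<open>k\<close>-th moments when the moments of order \<open>1, \<dots>, k - 1\<close> are prescribed by \<open>m\<close>.\<close>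

definition moment_fibre :: "real set \<Rightarrow> (nat \<Rightarrow> real) \<Rightarrow> nat \<Rightarrow> real set" where
  "moment_fibre T m k =
     {moment M k | M. M \<in> moment_measures T \<and> (\<forall>i\<in>{1..<k}. moment M i = m i)}"

text \<open>The minimum and maximum of the fibre. They are meaningful only where these are attained, in
  particular when \<open>(m 1, \<dots>, m (k - 1))\<close> is interior to the respective moment space (the maximum
  only for bounded \<open>T\<close>). In the functions \<open>f_dens\<close> and \<open>g_dens\<close> below, any index \<open>k\<close> for which
  this fails is preceded by an index whose indicator factor is 0, so the unspecified values do not matter.\<close>

definition m_minus :: "real set \<Rightarrow> (nat \<Rightarrow> real) \<Rightarrow> nat \<Rightarrow> real" where
  "m_minus T m k = (LEAST y. y \<in> moment_fibre T m k)"

definition m_plus :: "real set \<Rightarrow> (nat \<Rightarrow> real) \<Rightarrow> nat \<Rightarrow> real" where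
  "m_plus T m k = (GREATEST y. y \<in> moment_fibre T m k)"

text \<open>For \<open>k = 1\<close> the denominator is \<open>1 - 0\<close>, by the conventions for the moment of order 0 and its
  lower bound.\<close>

definition z_coord :: "(nat \<Rightarrow> real) \<Rightarrow> nat \<Rightarrow> real" where
  "z_coord m k = (m k - m_minus {0..} m k) /
     (if k = 1 then 1 else m (k - 1) - m_minus {0..} m (k - 1))"

definition c_compact :: "nat \<Rightarrow> real \<Rightarrow> (nat \<Rightarrow> real) \<Rightarrow> (nat \<Rightarrow> real) \<Rightarrow> real" where
  "c_compact n d \<gamma> \<delta> = inverse (d ^ (n * (n + 1) div 2) *
     (\<Prod>k=1..n. LBINT x:{0..1}. x powr (real n - real k + \<gamma> k) * (1 - x) powr (real n - real k + \<delta> k)))"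

definition f_dens :: "nat \<Rightarrow> real \<Rightarrow> (nat \<Rightarrow> real) \<Rightarrow> (nat \<Rightarrow> real) \<Rightarrow> (nat \<Rightarrow> real) \<Rightarrow> real" where
  "f_dens n d \<gamma> \<delta> m = c_compact n d \<gamma> \<delta> *
     (\<Prod>k=1..n. let a = m_minus {0..d} m k; b = m_plus {0..d} m k in
        ((m k - a) / (b - a)) powr \<gamma> k * ((b - m k) / (b - a)) powr \<delta> k * of_bool (a < m k \<and> m k < b))"

definition c_unbounded :: "nat \<Rightarrow> (nat \<Rightarrow> real) \<Rightarrow> (nat \<Rightarrow> real) \<Rightarrow> real" where
  "c_unbounded n \<gamma> \<delta> = (\<Prod>k=1..n.
     \<delta> k powr (\<gamma> k + real n - real k + 1) / Gamma (\<gamma> k + real n - real k + 1))"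

definition g_dens :: "nat \<Rightarrow> (nat \<Rightarrow> real) \<Rightarrow> (nat \<Rightarrow> real) \<Rightarrow> (nat \<Rightarrow> real) \<Rightarrow> real" where
  "g_dens n \<gamma> \<delta> m = c_unbounded n \<gamma> \<delta> *
     (\<Prod>k=1..n. z_coord m k powr \<gamma> k * exp (- \<delta> k * z_coord m k) * of_bool (z_coord m k > 0))"

text \<open>Probability densities on a moment space are required to vanish outside its interior.\<close>

definition density_on_moment_space :: "nat \<Rightarrow> real set \<Rightarrow> ((nat \<Rightarrow> real) \<Rightarrow> real) \<Rightarrow> bool" where
  "density_on_moment_space n T h \<longleftrightarrow>
     h \<in> borel_measurable (lebesgue_n n) \<and>
     (\<forall>m\<in>space (lebesgue_n n). 0 \<le> h m) \<and>
     (\<forall>m\<in>space (lebesgue_n n) - (euclidean_n n interior_of moment_space n T). h m = 0) \<and>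
     (\<integral>\<^sup>+m. ennreal (h m) \<partial>lebesgue_n n) = 1"

end

theory Submission
  imports Defs
begin

text \<open>
  Substitute \<open>x = y\<^sup>2\<close>, so that a measure on the half line becomes a symmetric measure on the
  real line. Its monic orthogonal polynomials \<open>H k = ortho m k\<close> satisfy
  \<open>H (k + 1) = y * H k - gap_ratio m k * H (k - 1)\<close>, where
  \<open>gap_ratio m k = moment_gap m k / moment_gap m (k - 1)\<close> and \<open>moment_gap m k\<close> is the integral of
  \<open>(H k)\<^sup>2\<close>. As \<open>(H k)\<^sup>2\<close> is a nonnegative monic polynomial of degree \<open>k\<close> in \<open>x\<close> that vanishes on
  the support of the Gauss quadrature at the roots of \<open>H k\<close>, its integral is
  \<open>m k - m_minus {0..} m k\<close> (\<open>m_minus_eq\<close>). So the coordinates \<open>z_coord\<close> are the coefficients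
  \<open>gap_ratio\<close> of the Stieltjes continued fraction, and an interior point is one where all of them
  are positive. The support is finite, so \<open>{0..d}\<close> has the same lower bound once \<open>d\<close> is large.

  The upper bound for \<open>{0..d}\<close> comes from the same quadrature, with the coefficient of order \<open>k\<close>
  changed to the value \<open>t\<close> for which \<open>y * H k - t * H (k - 1)\<close> vanishes at \<open>y = sqrt d\<close>
  (\<open>m_plus_eq\<close>). Hence \<open>m_plus - m_minus = t * moment_gap m (k - 1)\<close>, and the two ratios in the
  density on \<open>{0..d}\<close> are \<open>gap_ratio m k / t\<close> and \<open>1 - gap_ratio m k / t\<close>. Since \<open>H k\<close> and
  \<open>H (k - 1)\<close> are monic, \<open>t / d\<close> tends to 1, and since the second exponent grows like \<open>\<delta> k * d\<close>,
  the second power tends to \<open>exp (- \<delta> k * gap_ratio m k)\<close>. The powers of \<open>d\<close> that arise from the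
  first ratio cancel against those of the beta integrals in the normalising constant, which after
  scaling tend to gamma integrals (\<open>scaled_Beta_tendsto_Gamma\<close>). At a point where some gap is not
  positive, the first such index makes the density on \<open>{0..d}\<close> vanish for large \<open>d\<close>, and the limit
  function too.

  For the total mass of the limit, note that \<open>m k\<close> is an affine function of \<open>gap_ratio m k\<close> with
  slope \<open>moment_gap m (k - 1)\<close>, the product of the earlier coordinates. Integrating the last
  moment first thus leaves an integral of the same form with all remaining exponents raised by 1
  (\<open>nn_integral_prod_gamma_kernel\<close>).
\<close>

section \<open>The symmetrised moment functional\<close>

text \<open>The substitution \<open>x = y\<^sup>2\<close> turns a measure on the half line into a symmetric
  measure on the real line. Its odd moments vanish and its moment of order \<open>2 * i\<close> is \<open>m i\<close>; its
  moment of order 0 is the total mass 1.\<close>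

definition sym_moment :: "(nat \<Rightarrow> real) \<Rightarrow> nat \<Rightarrow> real" where
  "sym_moment m i = (if odd i then 0 else if i = 0 then 1 else m (i div 2))"

text \<open>Integration of a polynomial in \<open>y\<close> against the symmetrised measure, defined for an
  arbitrary sequence \<open>m\<close> whether or not a representing measure exists.\<close>

definition sym_functional :: "(nat \<Rightarrow> real) \<Rightarrow> real poly \<Rightarrow> real" where
  "sym_functional m p = (\<Sum>i\<le>degree p. coeff p i * sym_moment m i)"

lemma sym_functional_eq_sum:
  assumes "degree p \<le> K"
  shows "sym_functional m p = (\<Sum>i\<le>K. coeff p i * sym_moment m i)"
  unfolding sym_functional_def using assms
  by (intro sum.mono_neutral_left) (auto simp: coeff_eq_0)

lemma sym_functional_add: "sym_functional m (p + q) = sym_functional m p + sym_functional m q"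
proof -
  define K where "K = max (degree p) (degree q)"
  have "degree (p + q) \<le> K" "degree p \<le> K" "degree q \<le> K"
    by (auto simp: K_def intro: degree_add_le)
  then show ?thesis by (simp add: sym_functional_eq_sum algebra_simps sum.distrib)
qed

lemma sym_functional_smult: "sym_functional m (smult c p) = c * sym_functional m p"
  by (simp add: sym_functional_eq_sum[of "smult c p" "degree p"] sym_functional_def sum_distrib_left algebra_simps
      degree_smult_le)

lemma sym_functional_diff: "sym_functional m (p - q) = sym_functional m p - sym_functional m q"
  using sym_functional_add[of m p "smult (-1) q"] sym_functional_smult[of m "-1" q] by simp

lemma sym_functional_zero [simp]: "sym_functional m 0 = 0"
  by (simp add: sym_functional_def)

lemma sym_functional_one [simp]: "sym_functional m 1 = 1"
  by (simp add: sym_functional_def sym_moment_def)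

lemma sym_functional_sum: "sym_functional m (\<Sum>i\<in>A. f i) = (\<Sum>i\<in>A. sym_functional m (f i))"
  by (induction A rule: infinite_finite_induct) (auto simp: sym_functional_add)

lemma sym_functional_monom: "sym_functional m (monom 1 i) = sym_moment m i"
  by (simp add: sym_functional_eq_sum[of _ i] degree_monom_le if_distrib[of "\<lambda>x. x * _"] cong: if_cong)

text \<open>The last moment enters only through the top coefficient. With \<open>coeff p (2 * k) = 1\<close>
  or \<open>- 1\<close>, a sign of the functional on \<open>p\<close> is therefore a bound on \<open>m k\<close> in terms of the earlier
  moments; this is how the extremal moments are found below.\<close>

lemma sym_functional_cong_top:
  assumes "degree p \<le> 2 * k" "k \<ge> 1" "\<And>j. j \<in> {1..<k} \<Longrightarrow> m j = m' j"
  shows "sym_functional m p - sym_functional m' p = coeff p (2 * k) * (m k - m' k)"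
proof -
  have 1: "coeff p i * sym_moment m i - coeff p i * sym_moment m' i
      = (if i = 2 * k then coeff p (2 * k) * (m k - m' k) else 0)" if "i \<le> 2 * k" for i
  proof (cases "i = 2 * k \<or> odd i \<or> i = 0")
    case True
    then show ?thesis using assms(2) by (auto simp: sym_moment_def algebra_simps)
  next
    case False
    then have "i div 2 \<in> {1..<k}" using that by auto
    then show ?thesis using False assms(3) by (auto simp: sym_moment_def)
  qed
  have "sym_functional m p - sym_functional m' p
      = (\<Sum>i\<le>2*k. coeff p i * sym_moment m i - coeff p i * sym_moment m' i)"
    using assms(1) by (simp add: sym_functional_eq_sum sum_subtractf)
  also have "\<dots> = (\<Sum>i\<le>2*k. if i = 2 * k then coeff p (2 * k) * (m k - m' k) else 0)"
    by (intro sum.cong refl 1) auto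
  finally show ?thesis by simp
qed

lemma sym_functional_cong:
  assumes "degree p \<le> 2 * k + 1" "\<And>j. j \<in> {1..k} \<Longrightarrow> m j = m' j"
  shows "sym_functional m p = sym_functional m' p"
  using sym_functional_cong_top[of p "Suc k" m m'] assms by (auto simp: coeff_eq_0)

section \<open>Orthogonal polynomials\<close>

text \<open>The monic orthogonal polynomials of the symmetrised functional. By symmetry the
  middle coefficient of their three-term recurrence vanishes, so that the remaining coefficients
  are exactly those of the Stieltjes continued fraction.\<close>

fun ortho :: "(nat \<Rightarrow> real) \<Rightarrow> nat \<Rightarrow> real poly" where
  "ortho m 0 = 1"
| "ortho m (Suc 0) = [:0, 1:]"
| "ortho m (Suc (Suc k)) = [:0, 1:] * ortho m (Suc k)
     - smult (sym_functional m ((ortho m (Suc k))\<^sup>2) / sym_functional m ((ortho m k)\<^sup>2)) (ortho m k)"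

text \<open>The squared norm of the orthogonal polynomial, which turns out to be the gap
  \<open>m k - m_minus {0..} m k\<close> above the lower bound when the earlier gaps are positive.\<close>

definition moment_gap :: "(nat \<Rightarrow> real) \<Rightarrow> nat \<Rightarrow> real" where
  "moment_gap m k = sym_functional m ((ortho m k)\<^sup>2)"

text \<open>For interior points this is the coordinate \<open>z_coord m k\<close>. In contrast to \<open>z_coord\<close>
  it is a rational function of the moments, so that its measurability and continuity can be read
  off.\<close>

definition gap_ratio :: "(nat \<Rightarrow> real) \<Rightarrow> nat \<Rightarrow> real" where
  "gap_ratio m k = moment_gap m k / moment_gap m (k - 1)"

lemma ortho_rec:
  assumes "k \<ge> 1"
  shows "ortho m (Suc k) = [:0, 1:] * ortho m k - smult (gap_ratio m k) (ortho m (k - 1))"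
  using assms by (cases k) (auto simp: gap_ratio_def moment_gap_def)

lemma moment_gap_0 [simp]: "moment_gap m 0 = 1"
  by (simp add: moment_gap_def)

lemma ortho_monic: "degree (ortho m k) = k \<and> coeff (ortho m k) k = 1"
proof (induction m k rule: ortho.induct)
  case (3 m k)
  have "degree ([:0, 1:] * ortho m (Suc k)) = Suc (Suc k)"
    using 3 by (subst degree_mult_eq) auto
  moreover have "coeff ([:0, 1:] * ortho m (Suc k)) (Suc (Suc k)) = 1" using 3 by simp
  moreover have "coeff (ortho m k) (Suc (Suc k)) = 0" using 3 by (intro coeff_eq_0) auto
  moreover have "ortho m (Suc (Suc k)) = [:0, 1:] * ortho m (Suc k)
      + smult (- gap_ratio m (Suc k)) (ortho m k)"
    using ortho_rec[of "Suc k" m] by (simp del: ortho.simps)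
  moreover have "degree (smult (- gap_ratio m (Suc k)) (ortho m k)) < Suc (Suc k)"
    using 3 by (simp add: le_less_trans[OF degree_smult_le])
  ultimately show ?case
    using degree_add_eq_left[of "smult (- gap_ratio m (Suc k)) (ortho m k)" "[:0, 1:] * ortho m (Suc k)"]
    by (simp del: ortho.simps mult_pCons_left degree_smult_eq)
qed auto

lemma degree_ortho [simp]: "degree (ortho m k) = k"
  and coeff_ortho [simp]: "coeff (ortho m k) k = 1"
  using ortho_monic by auto

lemma ortho_nz [simp]: "ortho m k \<noteq> 0"
  using coeff_ortho[of m k] by (metis coeff_0 zero_neq_one)

lemma degree_ortho_sq [simp]: "degree ((ortho m k)\<^sup>2) = 2 * k"
  by (simp add: power2_eq_square degree_mult_eq)

lemma coeff_ortho_sq [simp]: "coeff ((ortho m k)\<^sup>2) (2 * k) = 1"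
  using coeff_mult_degree_sum[of "ortho m k" "ortho m k"]
  by (simp add: power2_eq_square mult_2)

lemma poly_ortho_minus: "poly (ortho m k) (- y) = (- 1) ^ k * poly (ortho m k) y"
proof (induction m k rule: ortho.induct)
  case (3 m k)
  then show ?case by (simp add: algebra_simps)
qed auto

text \<open>The polynomials alternate between even and odd; in the recurrence this is the
  absence of a middle term.\<close>

lemma coeff_ortho_odd: "odd (i + k) \<Longrightarrow> coeff (ortho m k) i = 0"
proof (induction m k arbitrary: i rule: ortho.induct)
  case (3 m k)
  then show ?case by (cases i) auto
qed (auto simp: coeff_pCons odd_pos split: nat.splits)

lemma sym_functional_ortho_odd:
  assumes "odd (i + j)"
  shows "sym_functional m (ortho m i * ortho m j) = 0"
proof -
  have "coeff (ortho m i * ortho m j) l * sym_moment m l = 0" for l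
  proof (cases "odd l")
    case True
    then show ?thesis by (simp add: sym_moment_def)
  next
    case False
    have "coeff (ortho m i) u * coeff (ortho m j) (l - u) = 0" if "u \<le> l" for u
    proof (cases "odd (u + i)")
      case True
      then show ?thesis by (simp add: coeff_ortho_odd)
    next
      case F: False
      have "odd (l - u + j)" using F False that assms by auto
      then show ?thesis by (simp add: coeff_ortho_odd)
    qed
    then have "coeff (ortho m i * ortho m j) l = 0"
      unfolding coeff_mult by (intro sum.neutral) auto
    then show ?thesis by simp
  qed
  then show ?thesis unfolding sym_functional_def by (intro sum.neutral ballI)
qed

text \<open>The coefficient \<open>gap_ratio m k\<close> is chosen to make consecutive polynomials of equal
  parity orthogonal. Polynomials of different parity are orthogonal anyway, and lower degrees are
  handled by moving the factor \<open>y\<close> from one polynomial to the other.\<close>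

lemma sym_functional_ortho_orthogonal:
  assumes "\<And>k. k \<in> {1..<N} \<Longrightarrow> moment_gap m k \<noteq> 0"
  shows "j \<le> N \<Longrightarrow> i < j \<Longrightarrow> sym_functional m (ortho m i * ortho m j) = 0"
proof (induction j arbitrary: i rule: less_induct)
  case (less j)
  have nz: "moment_gap m k \<noteq> 0" if "k < N" for k using assms[of k] that by (cases "k = 0") auto
  show ?case
  proof (cases "j = 1 \<or> odd (i + j)")
    case True
    then show ?thesis using less.prems by (intro sym_functional_ortho_odd) auto
  next
    case False
    define k where "k = j - 2"
    have j: "j = Suc (Suc k)" using False less.prems unfolding k_def by presburger
    have i: "i \<le> k" using False less.prems j by (cases "i = Suc k") auto
    have xi: "sym_functional m ([:0, 1:] * ortho m i * ortho m (Suc k))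
        = sym_functional m (ortho m (Suc i) * ortho m (Suc k))"
    proof (cases "i = 0")
      case False
      have "[:0, 1:] * ortho m i * ortho m (Suc k) = ortho m (Suc i) * ortho m (Suc k)
          + smult (gap_ratio m i) (ortho m (i - 1) * ortho m (Suc k))"
      proof -
        have "[:0, 1:] * ortho m i = ortho m (Suc i) + smult (gap_ratio m i) (ortho m (i - 1))"
          using ortho_rec[of i m] False by (simp del: mult_pCons_left ortho.simps)
        then show ?thesis by (simp only: distrib_right mult_smult_left)
      qed
      moreover have "sym_functional m (ortho m (i - 1) * ortho m (Suc k)) = 0"
        using i less.prems j False by (intro less.IH) auto
      ultimately show ?thesis by (simp only: sym_functional_add sym_functional_smult mult_zero_right add_0_right)
    qed auto
    have "ortho m j = [:0, 1:] * ortho m (Suc k) - smult (gap_ratio m (Suc k)) (ortho m k)"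
      unfolding j using ortho_rec[of "Suc k" m] by (simp del: ortho.simps)
    then have "ortho m i * ortho m j = [:0, 1:] * ortho m i * ortho m (Suc k)
        - smult (gap_ratio m (Suc k)) (ortho m i * ortho m k)"
      by (simp only: right_diff_distrib mult_smult_right ac_simps)
    then have eq: "sym_functional m (ortho m i * ortho m j) = sym_functional m (ortho m (Suc i) * ortho m (Suc k))
        - gap_ratio m (Suc k) * sym_functional m (ortho m i * ortho m k)"
      by (simp only: sym_functional_diff sym_functional_smult xi)
    show ?thesis
    proof (cases "i = k")
      case True
      then show ?thesis using eq nz[of k] less.prems j
        by (simp add: gap_ratio_def moment_gap_def power2_eq_square)
    next
      case F: False
      then show ?thesis using eq less.IH[of "Suc k" "Suc i"] less.IH[of k i] i less.prems j by simp
    qed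
  qed
qed

lemma degree_diff_lead_less:
  fixes p q :: "real poly"
  assumes "degree p = degree q" "lead_coeff p = lead_coeff q"
  shows "p - q = 0 \<or> degree (p - q) < degree p"
  using assms by (metis coeff_diff degree_diff_le diff_self le_refl le_neq_implies_less leading_coeff_0_iff)

lemma sym_functional_ortho_lower_degree:
  assumes "\<And>k. k \<in> {1..<N} \<Longrightarrow> moment_gap m k \<noteq> 0" "j \<le> N" "degree p < j"
  shows "sym_functional m (p * ortho m j) = 0"
  using assms(3)
proof (induction "degree p" arbitrary: p rule: less_induct)
  case less
  define q where "q = smult (lead_coeff p) (ortho m (degree p))"
  have p: "p * ortho m j = (p - q) * ortho m j + smult (lead_coeff p) (ortho m (degree p) * ortho m j)"
    by (simp add: q_def algebra_simps)
  have orth: "sym_functional m (ortho m (degree p) * ortho m j) = 0"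
    using sym_functional_ortho_orthogonal[OF assms(1,2) less.prems] .
  have "p - q = 0 \<or> degree (p - q) < degree p"
  proof (cases "p = 0")
    case False
    then show ?thesis by (intro degree_diff_lead_less) (auto simp: q_def)
  qed (auto simp: q_def)
  then have "sym_functional m ((p - q) * ortho m j) = 0"
    using less.hyps[of "p - q"] less.prems by auto
  then show ?case using orth by (subst p) (simp add: sym_functional_add sym_functional_smult)
qed

text \<open>Expanding \<open>p\<close> in orthogonal polynomials makes the value a combination of the
  numbers \<open>moment_gap m k\<close> with squares as weights.\<close>

lemma sym_functional_square_nonneg:
  assumes "\<And>k. k \<in> {1..<N} \<Longrightarrow> moment_gap m k > 0" "degree p < N"
  shows "0 \<le> sym_functional m (p\<^sup>2)"
  using assms(2)
proof (induction "degree p" arbitrary: p rule: less_induct)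
  case less
  define c where "c = lead_coeff p"
  define q where "q = ortho m (degree p)"
  define r where "r = p - smult c q"
  have deg: "r = 0 \<or> degree r < degree p"
  proof (cases "p = 0")
    case False
    then show ?thesis unfolding r_def by (intro degree_diff_lead_less) (auto simp: q_def c_def)
  qed (auto simp: q_def r_def c_def)
  have "p = r + smult c q" by (simp add: r_def)
  then have "p\<^sup>2 = r\<^sup>2 + (smult c (r * q) + smult c (r * q)) + smult (c\<^sup>2) (q\<^sup>2)"
    by (simp add: power2_eq_square algebra_simps)
  then have "sym_functional m (p\<^sup>2) = sym_functional m (r\<^sup>2) + 2 * c * sym_functional m (r * q) + c\<^sup>2 * moment_gap m (degree p)"
    by (simp only: sym_functional_add sym_functional_smult moment_gap_def q_def)
  moreover have "sym_functional m (r * q) = 0"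
    using deg sym_functional_ortho_lower_degree[of N m "degree p" r] assms(1) less.prems
    by (force simp: q_def)
  moreover have "0 \<le> sym_functional m (r\<^sup>2)" using deg less by auto
  moreover have "0 \<le> moment_gap m (degree p)"
    using assms(1)[of "degree p"] less.prems by (cases "degree p = 0") (auto simp: less_imp_le)
  ultimately show ?case by simp
qed

section \<open>Roots and Gauss quadrature\<close>

lemma monic_eq_prod_roots:
  fixes p :: "real poly"
  assumes "degree p = N" "coeff p N = 1" "inj_on r {..<N}" "\<And>i. i < N \<Longrightarrow> poly p (r i) = 0"
  shows "p = (\<Prod>i<N. [:- r i, 1:])"
proof (rule poly_eqI_degree_lead_coeff)
  have d: "degree (\<Prod>i<N. [:- r i, 1:]) = N" by (subst degree_prod_sum_eq) auto
  then show "coeff p N = coeff (\<Prod>i<N. [:- r i, 1:]) N"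
    using lead_coeff_prod[of "\<lambda>i. [:- r i, 1:]" "{..<N}"] assms by simp
  show "degree (\<Prod>i<N. [:- r i, 1:]) \<le> N" using d by simp
  show "N \<le> card (r ` {..<N})" using assms by (simp add: card_image)
  show "poly p z = poly (\<Prod>i<N. [:- r i, 1:]) z" if "z \<in> r ` {..<N}" for z
    using that assms(4) by (auto simp: poly_prod)
qed (use assms in auto)

lemma prod_sign_flip:
  fixes f :: "nat \<Rightarrow> real"
  assumes "i \<le> N"
  shows "(- 1) ^ i * (\<Prod>j<N. f j) = (\<Prod>j<N. if j < i then - f j else f j)"
proof -
  have "(- 1) ^ i = (\<Prod>j<N. if j < i then - 1 else (1::real))"
  proof -
    have "{..<N} \<inter> {j. j < i} = {..<i}" using assms by auto
    then show ?thesis by (simp add: prod.If_cases)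
  qed
  then show ?thesis by (simp add: prod.distrib[symmetric] if_distrib[of "\<lambda>x. x * _"] cong: if_cong)
qed

text \<open>Sturm's interlacing argument. At the roots \<open>r i\<close> of the polynomial of degree \<open>N\<close>
  the recurrence shows that the next polynomial has the sign opposite to that of the previous one.
  These signs alternate, so the next polynomial has a root in each gap, and its behaviour at
  infinity gives one more root on either side. The sign condition is part of the induction; it
  also locates all roots but the largest one in \<open>m_plus_eq\<close>.\<close>

lemma ortho_roots:
  assumes "\<And>k. k \<in> {1..<N} \<Longrightarrow> moment_gap m k > 0"
  shows "\<exists>r. (\<forall>i j. i < j \<longrightarrow> j < N \<longrightarrow> r j < r i) \<and> ortho m N = (\<Prod>i<N. [:- r i, 1:])
    \<and> (\<forall>i<N. 0 < (- 1) ^ i * poly (ortho m (N - 1)) (r i))"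
  using assms
proof (induction N)
  case (Suc N)
  show ?case
  proof (cases "N = 0")
    case True
    then show ?thesis by (intro exI[of _ "\<lambda>_. 0"]) auto
  next
    case False
    have "\<And>k. k \<in> {1..<N} \<Longrightarrow> moment_gap m k > 0" using Suc.prems by auto
    from Suc.IH[OF this] obtain r where r: "\<And>i j. i < j \<Longrightarrow> j < N \<Longrightarrow> r j < r i"
      "ortho m N = (\<Prod>i<N. [:- r i, 1:])"
      "\<And>i. i < N \<Longrightarrow> 0 < (- 1) ^ i * poly (ortho m (N - 1)) (r i)" by metis
    have "moment_gap m N > 0" "moment_gap m (N - 1) > 0"
      using Suc.prems[of N] Suc.prems[of "N - 1"] False by (cases "N = 1"; force)+
    then have zpos: "gap_ratio m N > 0" by (simp add: gap_ratio_def)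
    define P where "P = ortho m (Suc N)"
    have P: "P = [:0, 1:] * ortho m N - smult (gap_ratio m N) (ortho m (N - 1))"
      using ortho_rec[of N m] False by (simp add: P_def)
    have PN: "poly (ortho m N) (r i) = 0" if "i < N" for i
      using that by (auto simp: r(2) poly_prod)
    have Pr: "(- 1) ^ i * poly P (r i) < 0" if "i < N" for i
    proof -
      have "(- 1) ^ i * poly P (r i) = - (gap_ratio m N * ((- 1) ^ i * poly (ortho m (N - 1)) (r i)))"
        by (simp add: P PN that)
      then show ?thesis using r(3)[OF that] zpos by simp
    qed
    have lc: "lead_coeff P = 1" by (simp add: P_def del: ortho.simps)
    obtain b where b: "\<And>x. x \<ge> b \<Longrightarrow> 1 \<le> poly P x"
      using poly_pinfty_gt_lc[of P] unfolding lc by auto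
    define B where "B = max b (max (r 0 + 1) (- r (N - 1) + 1))"
    have B: "poly P B > 0" "r 0 < B" "- B < r (N - 1)"
      using b[of B] by (auto simp: B_def)
    \<comment> \<open>the old roots framed by \<open>B\<close> and \<open>- B\<close>, points where the sign of the new polynomial is known\<close>
    define e where "e i = (if i = 0 then B else if i \<le> N then r (i - 1) else - B)" for i
    have rN: "r (N - 1) \<le> r i" if "i < N" for i
      using r(1)[of i "N - 1"] that by (cases "i = N - 1") (auto intro: less_imp_le)
    have r0: "r i \<le> r 0" if "i < N" for i
      using r(1)[of 0 i] that by (cases "i = 0") auto
    have e: "e j < e i" if "i < j" "j \<le> Suc N" for i j
    proof (cases "i = 0")
      case True
      obtain j' where j': "j = Suc j'" using \<open>i < j\<close> by (cases j) auto
      show ?thesis using True \<open>j \<le> Suc N\<close> B r0[of j'] rN[of 0] False by (auto simp: e_def j')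
    next
      case i0: False
      show ?thesis
      proof (cases "j \<le> N")
        case True
        then show ?thesis using i0 that r(1)[of "i - 1" "j - 1"] by (auto simp: e_def)
      next
        case F: False
        obtain i' where i': "i = Suc i'" using i0 by (cases i) auto
        show ?thesis using F \<open>i < j\<close> \<open>j \<le> Suc N\<close> rN[of i'] B by (auto simp: e_def i')
      qed
    qed
    have sgn: "0 < (- 1) ^ i * poly P (e i)" if "i \<le> Suc N" for i
    proof (cases "i = 0")
      case True
      then show ?thesis using B by (simp add: e_def)
    next
      case i0: False
      show ?thesis
      proof (cases "i \<le> N")
        case True
        have "(- 1) ^ i = - ((- 1) ^ (i - 1) :: real)" using i0 by (cases i) auto
        then show ?thesis using Pr[of "i - 1"] True i0 by (simp add: e_def)
      next
        case F: False
        then have "i = Suc N" using that by simp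
        then show ?thesis using B poly_ortho_minus[of m "Suc N" B]
          by (simp add: e_def P_def power_mult_distrib[symmetric] del: ortho.simps)
      qed
    qed
    have "\<exists>x. e (Suc i) < x \<and> x < e i \<and> poly P x = 0" if "i \<le> N" for i
    proof -
      have "0 < ((- 1) ^ i * poly P (e i)) * ((- 1) ^ Suc i * poly P (e (Suc i)))"
        using that by (intro mult_pos_pos[OF sgn sgn]) auto
      also have "\<dots> = - (poly P (e (Suc i)) * poly P (e i)) * ((- 1) ^ i * (- 1) ^ i)" by simp
      also have "((- 1) ^ i * (- 1) ^ i :: real) = 1" by (simp add: power_mult_distrib[symmetric])
      finally show ?thesis using poly_IVT[of "e (Suc i)" "e i" P] e[of i "Suc i"] that by auto
    qed
    then obtain s where s: "\<And>i. i \<le> N \<Longrightarrow> e (Suc i) < s i \<and> s i < e i \<and> poly P (s i) = 0"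
      by metis
    have e_le: "e j \<le> e i" if "i \<le> j" "j \<le> Suc N" for i j
      using e[of i j] that by (cases "i = j") auto
    have s_dec: "s j < s i" if "i < j" "j < Suc N" for i j
      using s[of i] s[of j] e_le[of "Suc i" j] that by auto
    have "inj_on s {..<Suc N}"
      by (rule inj_onI) (metis lessThan_iff linorder_neqE_nat s_dec less_irrefl)
    then have prod: "P = (\<Prod>i<Suc N. [:- s i, 1:])"
      using s by (intro monic_eq_prod_roots) (auto simp: P_def simp del: ortho.simps)
    have sgn_s: "0 < (- 1) ^ i * poly (ortho m N) (s i)" if "i < Suc N" for i
    proof -
      have "(- 1) ^ i * poly (ortho m N) (s i) = (- 1) ^ i * (\<Prod>j<N. s i - r j)"
        by (simp add: r(2) poly_prod)
      also have "\<dots> = (\<Prod>j<N. if j < i then - (s i - r j) else s i - r j)"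
        using that by (intro prod_sign_flip) auto
      also have "\<dots> > 0"
      proof (rule prod_pos)
        fix j assume "j \<in> {..<N}"
        then show "0 < (if j < i then - (s i - r j) else s i - r j)"
          using s[of i] e_le[of "Suc j" i] e_le[of "Suc i" "Suc j"] that by (auto simp: e_def)
      qed
      finally show ?thesis .
    qed
    show ?thesis using s_dec prod sgn_s by (intro exI[of _ s]) (auto simp: P_def simp del: ortho.simps)
  qed
qed auto

text \<open>Gauss quadrature: division by the orthogonal polynomial reduces the claim to
  degrees below \<open>N\<close>, where Lagrange interpolation at the roots is exact. The weights are the
  values of the functional on the Lagrange polynomials \<open>l i\<close>. Since the quadrature is exact on
  \<open>(l i)\<^sup>2\<close>, they are also the values of the functional on these squares, hence nonnegative.\<close>

lemma gauss_quadrature: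
  assumes pos: "\<And>k. k \<in> {1..<N} \<Longrightarrow> moment_gap m k > 0"
    and inj: "inj_on r {..<N}" and prod: "ortho m N = (\<Prod>i<N. [:- r i, 1:])"
  shows "\<exists>w. (\<forall>i<N. 0 \<le> w i) \<and> (\<forall>p. degree p < 2 * N \<longrightarrow> sym_functional m p = (\<Sum>i<N. w i * poly p (r i)))"
proof -
  define l where "l i = smult (inverse (\<Prod>j\<in>{..<N} - {i}. r i - r j)) (\<Prod>j\<in>{..<N} - {i}. [:- r j, 1:])" for i
  have deg_l: "degree (l i) < N" if "i < N" for i
  proof -
    have "degree (\<Prod>j\<in>{..<N} - {i}. [:- r j, 1:]) = N - 1"
      using that by (subst degree_prod_sum_eq) auto
    then show ?thesis using that degree_smult_le[of _ "\<Prod>j\<in>{..<N} - {i}. [:- r j, 1:]"]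
      by (auto simp: l_def intro: le_less_trans)
  qed
  have l_val: "poly (l i) (r j) = (if i = j then 1 else 0)" if "i < N" "j < N" for i j
  proof (cases "i = j")
    case True
    have "(\<Prod>j\<in>{..<N} - {i}. r i - r j) \<noteq> 0"
      using inj that by (auto simp: inj_on_def)
    then show ?thesis using True by (simp add: l_def poly_prod)
  next
    case False
    then show ?thesis using that by (auto simp: l_def poly_prod)
  qed
  have root: "poly (ortho m N) (r i) = 0" if "i < N" for i
    using that by (auto simp: prod poly_prod)
  have quad: "sym_functional m p = (\<Sum>i<N. sym_functional m (l i) * poly p (r i))" if deg: "degree p < 2 * N" for p
  proof -
    define q where "q = p div ortho m N"
    define s where "s = p mod ortho m N"
    have N: "N > 0" using deg by simp
    have p: "p = q * ortho m N + s" unfolding q_def s_def by (rule div_mult_mod_eq[symmetric])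
    have ds: "degree s < N"
      using degree_mod_less[of "ortho m N" p] N by (auto simp: s_def)
    have dq: "degree q < N"
    proof (cases "q = 0")
      case False
      then have "degree q + N = degree (q * ortho m N)" by (simp add: degree_mult_eq)
      also have "q * ortho m N = p - s" using p by simp
      also have "degree (p - s) \<le> 2 * N - 1"
        using deg ds by (intro degree_diff_le) auto
      finally show ?thesis using N by simp
    qed (use N in auto)
    have "sym_functional m (q * ortho m N) = 0"
      using pos dq by (intro sym_functional_ortho_lower_degree[of N]) force+
    then have Lp: "sym_functional m p = sym_functional m s" by (subst p) (simp add: sym_functional_add)
    have val: "poly s (r i) = poly p (r i)" if "i < N" for i
      using arg_cong[OF p, of "\<lambda>p. poly p (r i)"] by (simp add: root that)
    have "s = (\<Sum>i<N. smult (poly s (r i)) (l i))"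
    proof (rule poly_eqI_degree)
      show "poly s x = poly (\<Sum>i<N. smult (poly s (r i)) (l i)) x" if x: "x \<in> r ` {..<N}" for x
      proof -
        obtain j where j: "j < N" "x = r j" using x by auto
        have "poly (\<Sum>i<N. smult (poly s (r i)) (l i)) x = (\<Sum>i<N. if i = j then poly s (r j) else 0)"
          unfolding poly_sum j(2) using j(1) by (intro sum.cong) (auto simp: l_val)
        then show ?thesis using j by simp
      qed
      have c: "card (r ` {..<N}) = N" using inj by (simp add: card_image)
      show "degree s < card (r ` {..<N})" using ds c by simp
      have "degree (\<Sum>i<N. smult (poly s (r i)) (l i)) \<le> N - 1"
      proof (rule degree_sum_le)
        show "degree (smult (poly s (r i)) (l i)) \<le> N - 1" if "i \<in> {..<N}" for i
          using deg_l[of i] that degree_smult_le[of "poly s (r i)" "l i"] by simp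
      qed simp
      then show "degree (\<Sum>i<N. smult (poly s (r i)) (l i)) < card (r ` {..<N})"
        using N c by simp
    qed
    then have "sym_functional m s = (\<Sum>i<N. poly s (r i) * sym_functional m (l i))"
      by (metis (no_types, lifting) sym_functional_sum sym_functional_smult sum.cong)
    then show ?thesis using Lp val by (simp add: mult.commute)
  qed
  have "0 \<le> sym_functional m (l i)" if i: "i < N" for i
  proof -
    have "degree ((l i)\<^sup>2) < 2 * N"
      using deg_l[OF i] degree_mult_le[of "l i" "l i"] by (simp add: power2_eq_square)
    then have "sym_functional m ((l i)\<^sup>2) = (\<Sum>j<N. sym_functional m (l j) * (poly (l i) (r j))\<^sup>2)"
      using quad by simp
    also have "\<dots> = (\<Sum>j<N. if j = i then sym_functional m (l i) else 0)"
      using i by (intro sum.cong) (auto simp: l_val)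
    finally have "sym_functional m ((l i)\<^sup>2) = sym_functional m (l i)" using i by simp
    then show ?thesis using sym_functional_square_nonneg[OF pos deg_l[OF i]] by simp
  qed
  with quad show ?thesis by (intro exI[of _ "\<lambda>i. sym_functional m (l i)"]) auto
qed

section \<open>Representing measures\<close>

lemma space_moment_measure:
  assumes "M \<in> moment_measures T"
  shows "space M = T"
proof -
  have "sets M = sets (restrict_space borel T)" using assms by (simp add: moment_measures_def)
  from sets_eq_imp_space_eq[OF this] show ?thesis by (simp add: space_restrict_space)
qed

text \<open>Finitely supported measures, with the points allowed to coincide: in the
  application they are the squares of a symmetric set of nodes.\<close>

lemma moment_measure_exists:
  fixes N :: nat
  assumes w: "\<And>i. i < N \<Longrightarrow> 0 \<le> w i" "(\<Sum>i<N. w i) = 1" and x: "\<And>i. i < N \<Longrightarrow> x i \<in> T"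
  obtains M where "M \<in> moment_measures T"
    "\<And>f. f \<in> borel_measurable borel \<Longrightarrow> (\<integral>y. f y \<partial>M) = (\<Sum>i<N. w i * f (x i :: real) :: real)"
proof -
  define w' where "w' i = (if i < N then w i else 0)" for i
  have nn: "\<And>i. 0 \<le> w' i" using w(1) by (simp add: w'_def)
  have N: "N > 0" using w(2) by (cases N) auto
  have "(\<integral>\<^sup>+i. ennreal (w' i) \<partial>count_space UNIV) = (\<integral>\<^sup>+i. ennreal (w' i) \<partial>count_space {..<N})"
    by (rule nn_integral_count_space_eq) (auto simp: w'_def)
  also have "\<dots> = ennreal (\<Sum>i<N. w' i)"
    using nn by (subst nn_integral_count_space_finite) (auto simp: sum_ennreal)
  also have "(\<Sum>i<N. w' i) = 1" using w(2) by (simp add: w'_def)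
  finally have tot: "(\<integral>\<^sup>+i. ennreal (w' i) \<partial>count_space UNIV) = 1" by simp
  define p where "p = embed_pmf w'"
  have pmf: "pmf p i = w' i" for i
    unfolding p_def using nn tot by (simp add: pmf_embed_pmf)
  have set_p: "set_pmf p \<subseteq> {..<N}" by (auto simp: set_pmf_iff pmf w'_def split: if_splits)
  \<comment> \<open>the push-forward map must send every index into \<open>T\<close>, including those of weight 0\<close>
  define x' where "x' i = (if i < N then x i else x 0)" for i
  have x': "x' i \<in> T" for i using x N by (simp add: x'_def)
  have meas: "x' \<in> measure_pmf p \<rightarrow>\<^sub>M restrict_space borel T"
    using x' by (intro measurable_restrict_space2) auto
  define M where "M = distr (measure_pmf p) (restrict_space borel T) x'"
  have int: "(\<integral>y. f y \<partial>M) = (\<Sum>i<N. w i * f (x i))" if f: "f \<in> borel_measurable borel" for f :: "real \<Rightarrow> real"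
  proof -
    have "(\<integral>y. f y \<partial>M) = (\<integral>i. f (x' i) \<partial>measure_pmf p)"
      unfolding M_def using f by (intro integral_distr meas measurable_restrict_space1)
    also have "\<dots> = (\<Sum>i<N. f (x' i) * pmf p i)"
      using set_p by (intro integral_measure_pmf_real) auto
    also have "\<dots> = (\<Sum>i<N. w i * f (x i))"
      by (intro sum.cong) (auto simp: pmf w'_def x'_def)
    finally show ?thesis .
  qed
  have "integrable M (\<lambda>y. y ^ k)" for k
  proof -
    have "integrable (measure_pmf p) (\<lambda>i. x' i ^ k)"
      using set_p by (intro integrable_measure_pmf_finite) (auto intro: finite_subset)
    moreover have "(\<lambda>y::real. y ^ k) \<in> borel_measurable (restrict_space borel T)"
      by (intro measurable_restrict_space1) simp
    ultimately show ?thesis unfolding M_def using meas by (simp add: integrable_distr_eq)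
  qed
  moreover have "prob_space M" unfolding M_def by (rule measure_pmf.prob_space_distr[OF meas])
  ultimately have "M \<in> moment_measures T" by (simp add: moment_measures_def M_def)
  with int that show thesis by blast
qed

text \<open>Symmetrisation in \<open>y\<close>, as a function of \<open>x = y\<^sup>2\<close>; it keeps only the even powers,
  so that no square roots remain.\<close>

definition even_part :: "real poly \<Rightarrow> real \<Rightarrow> real" where
  "even_part p x = (poly p (sqrt x) + poly p (- sqrt x)) / 2"

lemma even_part_altdef:
  assumes "x \<ge> 0"
  shows "even_part p x = (\<Sum>i\<le>degree p. coeff p i * (if odd i then 0 else x ^ (i div 2)))"
proof -
  have "even_part p x = (\<Sum>i\<le>degree p. coeff p i * ((sqrt x ^ i + (- sqrt x) ^ i) / 2))"
    by (simp add: even_part_def poly_altdef sum.distrib[symmetric] sum_divide_distrib field_simps)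
  also have "\<dots> = (\<Sum>i\<le>degree p. coeff p i * (if odd i then 0 else x ^ (i div 2)))"
  proof (intro sum.cong refl arg_cong2[of _ _ _ _ "(*)"])
    show "(sqrt x ^ i + (- sqrt x) ^ i) / 2 = (if odd i then 0 else x ^ (i div 2))" for i
    proof (cases "odd i")
      case False
      then obtain j where "i = 2 * j" by auto
      then show ?thesis using assms by (simp add: power_mult)
    qed auto
  qed
  finally show ?thesis .
qed

lemma sym_functional_moment:
  assumes M: "M \<in> moment_measures T" and T: "T \<subseteq> {0..}"
  shows "sym_functional (moment M) p = (\<integral>x. even_part p x \<partial>M)"
proof -
  interpret prob_space M using M by (simp add: moment_measures_def)
  have int: "integrable M (\<lambda>x. x ^ k)" for k using M by (simp add: moment_measures_def)
  have int': "integrable M (\<lambda>x. if odd i then 0 else x ^ (i div 2))" for i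
    by (cases "odd i") (auto intro: int)
  have "(\<integral>x. even_part p x \<partial>M)
      = (\<integral>x. (\<Sum>i\<le>degree p. coeff p i * (if odd i then 0 else x ^ (i div 2))) \<partial>M)"
    using space_moment_measure[OF M] T by (intro Bochner_Integration.integral_cong refl even_part_altdef) auto
  also have "\<dots> = (\<Sum>i\<le>degree p. \<integral>x. coeff p i * (if odd i then 0 else x ^ (i div 2)) \<partial>M)"
    by (intro Bochner_Integration.integral_sum integrable_mult_right) (rule int')
  also have "\<dots> = sym_functional (moment M) p"
    unfolding sym_functional_def by (intro sum.cong) (auto simp: sym_moment_def moment_def prob_space)
  finally show ?thesis by simp
qed

text \<open>The quadrature nodes, squared, carry a measure with the prescribed moments up to
  order \<open>N - 1\<close>. The functional of that measure vanishes on every polynomial that vanishes at the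
  nodes, which identifies its moment of order \<open>N\<close> and makes it extremal.\<close>

lemma gauss_moment_measure:
  assumes pos: "\<And>k. k \<in> {1..<N} \<Longrightarrow> moment_gap m k > 0" and N: "N \<ge> 1"
    and supp: "\<And>y. poly (ortho m N) y = 0 \<Longrightarrow> y\<^sup>2 \<in> T" and T: "T \<subseteq> {0..}"
  obtains M where "M \<in> moment_measures T" "\<And>j. j \<in> {1..<N} \<Longrightarrow> moment M j = m j"
    "\<And>p. (\<And>y. poly (ortho m N) y = 0 \<Longrightarrow> poly p y = 0) \<Longrightarrow> sym_functional (moment M) p = 0"
proof -
  obtain r where r: "\<And>i j. i < j \<Longrightarrow> j < N \<Longrightarrow> r j < r i" "ortho m N = (\<Prod>i<N. [:- r i, 1:])"
    using ortho_roots[OF pos] by metis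
  have "inj_on r {..<N}"
    by (rule inj_onI) (metis lessThan_iff linorder_neqE_nat r(1) less_irrefl)
  from gauss_quadrature[OF pos this r(2)] obtain w where
    w: "\<And>i. i < N \<Longrightarrow> 0 \<le> w i" "\<And>p. degree p < 2 * N \<Longrightarrow> sym_functional m p = (\<Sum>i<N. w i * poly p (r i))"
    by auto
  have root: "poly (ortho m N) (r i) = 0" if "i < N" for i
    using that by (auto simp: r(2) poly_prod)
  have "(\<Sum>i<N. w i) = 1" using w(2)[of 1] N by simp
  from moment_measure_exists[of N w "\<lambda>i. (r i)\<^sup>2" T, OF w(1) this supp[OF root]]
  obtain M where M: "M \<in> moment_measures T"
    "\<And>f. f \<in> borel_measurable borel \<Longrightarrow> (\<integral>y. f y \<partial>M) = (\<Sum>i<N. w i * f ((r i)\<^sup>2) :: real)" by blast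
  show thesis
  proof
    fix j assume j: "j \<in> {1..<N}"
    have "moment M j = (\<Sum>i<N. w i * poly (monom 1 (2 * j)) (r i))"
      unfolding moment_def by (subst M(2)) (auto simp: poly_monom power_mult)
    also have "\<dots> = sym_functional m (monom 1 (2 * j))"
      using j by (subst w(2)) (auto intro: le_less_trans[OF degree_monom_le])
    finally show "moment M j = m j" using j by (simp add: sym_functional_monom sym_moment_def)
  next
    fix p assume p: "\<And>y. poly (ortho m N) y = 0 \<Longrightarrow> poly p y = 0"
    have "even_part p ((r i)\<^sup>2) = 0" if "i < N" for i
    proof -
      have "poly p (r i) = 0" "poly p (- r i) = 0"
        using root[OF that] by (auto intro!: p simp: poly_ortho_minus)
      then show ?thesis by (cases "r i \<ge> 0") (auto simp: even_part_def)
    qed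
    moreover have "even_part p \<in> borel_measurable borel"
      unfolding even_part_def
      by (intro borel_measurable_continuous_onI) (auto intro!: continuous_intros)
    ultimately show "sym_functional (moment M) p = 0"
      unfolding sym_functional_moment[OF M(1) T] by (simp add: M(2))
  qed (rule M(1))
qed

section \<open>Extremal moments\<close>

lemma moment_ge_low:
  assumes M: "M \<in> moment_measures T" and T: "T \<subseteq> {0..}" and k: "k \<ge> 1"
    and eq: "\<And>j. j \<in> {1..<k} \<Longrightarrow> moment M j = m j"
  shows "m k - moment_gap m k \<le> moment M k"
proof -
  have "0 \<le> sym_functional (moment M) ((ortho m k)\<^sup>2)"
    unfolding sym_functional_moment[OF M T] by (auto simp: even_part_def intro!: integral_nonneg_AE)
  then show ?thesis using sym_functional_cong_top[of "(ortho m k)\<^sup>2" k "moment M" m] k eq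
    by (simp add: moment_gap_def)
qed

text \<open>The square of the orthogonal polynomial is nonnegative, and its integral is \<open>m k\<close>
  plus terms in the earlier moments; hence the lower bound. Equality holds for the measure on the
  squared roots.\<close>

lemma m_minus_eq:
  assumes k: "k \<ge> 1" and pos: "\<And>j. j \<in> {1..<k} \<Longrightarrow> moment_gap m j > 0"
    and supp: "\<And>y. poly (ortho m k) y = 0 \<Longrightarrow> y\<^sup>2 \<in> T" and T: "T \<subseteq> {0..}"
  shows "m_minus T m k = m k - moment_gap m k"
  unfolding m_minus_def
proof (rule Least_equality)
  obtain M where M: "M \<in> moment_measures T" "\<And>j. j \<in> {1..<k} \<Longrightarrow> moment M j = m j"
    "\<And>p. (\<And>y. poly (ortho m k) y = 0 \<Longrightarrow> poly p y = 0) \<Longrightarrow> sym_functional (moment M) p = 0"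
    using gauss_moment_measure[OF pos k supp T] by blast
  have "sym_functional (moment M) ((ortho m k)\<^sup>2) = 0" by (rule M(3)) simp
  then have "moment M k = m k - moment_gap m k"
    using sym_functional_cong_top[of "(ortho m k)\<^sup>2" k "moment M" m] k M(2) by (simp add: moment_gap_def)
  then show "m k - moment_gap m k \<in> moment_fibre T m k"
    unfolding moment_fibre_def using M(1,2) by force
  show "m k - moment_gap m k \<le> y" if "y \<in> moment_fibre T m k" for y
    using that moment_ge_low[OF _ T k] by (auto simp: moment_fibre_def)
qed

lemma ortho_cong:
  assumes "\<And>j. j \<in> {1..<k} \<Longrightarrow> m j = m' j" "i \<le> k"
  shows "ortho m i = ortho m' i"
  using assms(2)
proof (induction i rule: less_induct)
  case (less i)
  show ?case
  proof (cases "i \<le> 1")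
    case True
    then show ?thesis by (cases i) auto
  next
    case False
    define l where "l = i - 2"
    have i: "i = Suc (Suc l)" using False by (simp add: l_def)
    have "sym_functional m ((ortho m j)\<^sup>2) = sym_functional m' ((ortho m' j)\<^sup>2)" if "j < i" for j
      using less.IH[OF that] that less.prems assms(1)
      by (simp only:) (intro sym_functional_cong[of _ j], auto)
    from this[of l] this[of "Suc l"]
    have sq: "sym_functional m ((ortho m l)\<^sup>2) = sym_functional m' ((ortho m' l)\<^sup>2)"
      "sym_functional m ((ortho m (Suc l))\<^sup>2) = sym_functional m' ((ortho m' (Suc l))\<^sup>2)" by (auto simp: i)
    have p: "ortho m l = ortho m' l" "ortho m (Suc l) = ortho m' (Suc l)"
      using less.IH[of l] less.IH[of "Suc l"] less.prems by (auto simp: i)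
    show ?thesis unfolding i ortho.simps(3) sq unfolding p ..
  qed
qed

lemma moment_gap_cong:
  assumes "\<And>j. j \<in> {1..k} \<Longrightarrow> m j = m' j"
  shows "moment_gap m k = moment_gap m' k"
proof -
  have "ortho m k = ortho m' k" using assms by (intro ortho_cong[of k]) auto
  then show ?thesis using assms unfolding moment_gap_def by (simp only:) (intro sym_functional_cong[of _ k], auto)
qed

lemma moment_gap_diff:
  assumes "\<And>j. j \<in> {1..<k} \<Longrightarrow> m j = m' j" "k \<ge> 1"
  shows "moment_gap m k - moment_gap m' k = m k - m' k"
proof -
  have "ortho m k = ortho m' k" using assms by (intro ortho_cong[of k]) auto
  then show ?thesis using sym_functional_cong_top[of "(ortho m k)\<^sup>2" k m m'] assms by (simp add: moment_gap_def)
qed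

text \<open>The value of the continued fraction coefficient of order \<open>k\<close> for which the next
  orthogonal polynomial vanishes at \<open>sqrt d\<close>.\<close>

definition upper_ratio :: "(nat \<Rightarrow> real) \<Rightarrow> nat \<Rightarrow> real \<Rightarrow> real" where
  "upper_ratio m k d = sqrt d * poly (ortho m k) (sqrt d) / poly (ortho m (k - 1)) (sqrt d)"

text \<open>Replace \<open>m k\<close> by the value for which the polynomial \<open>P\<close> of degree \<open>k + 1\<close> vanishes
  at \<open>sqrt d\<close>. Then \<open>P = (y\<^sup>2 - d) * R\<close>, all roots of \<open>P\<close> lie between \<open>- sqrt d\<close> and \<open>sqrt d\<close>, and
  the squared roots carry a measure on \<open>{0..d}\<close>. The polynomial \<open>(d - y\<^sup>2) * R\<^sup>2\<close> is nonnegative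
  for \<open>y\<^sup>2 \<le> d\<close>, has top coefficient \<open>- 1\<close>, and vanishes on that support, so this measure
  maximises the moment of order \<open>k\<close>.\<close>

lemma m_plus_eq:
  assumes k: "k \<ge> 1" and pos: "\<And>j. j \<in> {1..<k} \<Longrightarrow> moment_gap m j > 0" and d: "d > 0"
    and large: "\<And>y. y \<ge> sqrt d \<Longrightarrow> poly (ortho m k) y > 0" "poly (ortho m (k - 1)) (sqrt d) > 0"
  shows "m_plus {0..d} m k = m k - moment_gap m k + upper_ratio m k d * moment_gap m (k - 1)"
proof -
  define t where "t = upper_ratio m k d"
  have "t > 0" unfolding t_def upper_ratio_def using large d by (intro divide_pos_pos mult_pos_pos) auto
  have hpos: "moment_gap m (k - 1) > 0" using pos[of "k - 1"] k by (cases "k = 1") auto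
  define m' where "m' = m(k := m k - moment_gap m k + t * moment_gap m (k - 1))"
  have agree: "m' j = m j" if "j \<in> {1..<k}" for j using that by (simp add: m'_def)
  have orth: "ortho m' i = ortho m i" if "i \<le> k" for i
    using that agree by (intro ortho_cong[of k]) auto
  have hg: "moment_gap m' j = moment_gap m j" if "j < k" for j
    using that agree by (intro moment_gap_cong) auto
  have hk: "moment_gap m' k = t * moment_gap m (k - 1)"
    using moment_gap_diff[of k m' m] agree k by (simp add: m'_def)
  have pos': "moment_gap m' j > 0" if "j \<in> {1..<Suc k}" for j
    using that hk hg[of j] pos[of j] hpos \<open>t > 0\<close> by (cases "j = k") auto
  have zt: "gap_ratio m' k = t" using hk hg[of "k - 1"] hpos k by (simp add: gap_ratio_def)
  define P where "P = ortho m' (Suc k)"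
  have P: "P = [:0, 1:] * ortho m k - smult t (ortho m (k - 1))"
    using ortho_rec[of k m'] k by (simp add: P_def zt orth del: mult_pCons_left)
  have Pd: "poly P (sqrt d) = 0" using large(2) by (simp add: P t_def upper_ratio_def)
  then have Pd': "poly P (- sqrt d) = 0" by (simp add: P_def poly_ortho_minus del: ortho.simps)
  obtain r where r: "\<And>i j. i < j \<Longrightarrow> j < Suc k \<Longrightarrow> r j < r i" "P = (\<Prod>i<Suc k. [:- r i, 1:])"
      "\<And>i. i < Suc k \<Longrightarrow> 0 < (- 1) ^ i * poly (ortho m' (Suc k - 1)) (r i)"
    using ortho_roots[of "Suc k", OF pos'] unfolding P_def by metis
  \<comment> \<open>the sign condition at the second largest root puts it below \<open>sqrt d\<close>, hence all the others too\<close>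
  have r1: "r i < sqrt d" if "i \<ge> 1" "i \<le> k" for i
  proof -
    have "r 1 < sqrt d" using r(3)[of 1] large(1)[of "r 1"] orth[of k] that by force
    then show ?thesis using r(1)[of 1 i] that by (cases "i = 1") auto
  qed
  have rootE: "\<exists>a<Suc k. y = r a" if "poly P y = 0" for y
  proof -
    have "(\<Prod>i<Suc k. y - r i) = 0" using that by (simp add: r(2) poly_prod del: prod.lessThan_Suc)
    then show ?thesis by (auto simp: prod_zero_iff simp del: prod.lessThan_Suc)
  qed
  have root_le: "y \<le> sqrt d" if "poly P y = 0" for y
  proof -
    from rootE[OF Pd] obtain a where a: "a < Suc k" "sqrt d = r a" by auto
    then have "a = 0" using r1[of a] by (cases "a = 0") auto
    moreover from rootE[OF that] obtain b where b: "b < Suc k" "y = r b" by auto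
    ultimately show ?thesis using a r1[of b] by (cases "b = 0") auto
  qed
  have root_sq: "y\<^sup>2 \<in> {0..d}" if "poly P y = 0" for y
  proof -
    have "poly P (- y) = 0" using that by (simp add: P_def poly_ortho_minus del: ortho.simps)
    then have "\<bar>y\<bar> \<le> sqrt d" using root_le[of y] root_le[of "- y"] that by auto
    then have "\<bar>y\<bar>\<^sup>2 \<le> (sqrt d)\<^sup>2" by (intro power_mono) auto
    then show ?thesis using d by simp
  qed
  obtain M where M: "M \<in> moment_measures {0..d}" "\<And>j. j \<in> {1..<Suc k} \<Longrightarrow> moment M j = m' j"
    "\<And>p. (\<And>y. poly P y = 0 \<Longrightarrow> poly p y = 0) \<Longrightarrow> sym_functional (moment M) p = 0"
  proof (rule gauss_moment_measure[of "Suc k" m' "{0..d}", folded P_def])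
    show "{0..d} \<subseteq> {0..}" by auto
  qed (use pos' root_sq in auto)
  have "[:- d, 0, 1:] dvd P"
  proof -
    have 1: "[:- sqrt d, 1:] dvd P" using Pd by (simp add: poly_eq_0_iff_dvd)
    then obtain Q where Q: "P = [:- sqrt d, 1:] * Q" by (elim dvdE)
    have "poly Q (- sqrt d) = 0" using Pd' d unfolding Q by simp
    then have "[:sqrt d, 1:] dvd Q" by (simp add: poly_eq_0_iff_dvd)
    then have "[:- sqrt d, 1:] * [:sqrt d, 1:] dvd P" unfolding Q by (rule mult_dvd_mono[OF dvd_refl])
    then show ?thesis using d by simp
  qed
  then obtain R where R: "P = [:- d, 0, 1:] * R" by (elim dvdE)
  have Pdeg: "degree P = Suc k" "lead_coeff P = 1" by (simp_all add: P_def del: ortho.simps)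
  then have Rnz: "R \<noteq> 0" using R by auto
  have Rdeg: "degree R + 1 = k" using Pdeg(1) degree_mult_eq[of "[:- d, 0, 1:]" R] Rnz unfolding R by simp
  have Rlc: "lead_coeff R = 1" using Pdeg(2) unfolding R lead_coeff_mult by simp
  define S where "S = [:d, 0, - 1:] * R\<^sup>2"
  have Sdeg: "degree S = 2 * k"
    unfolding S_def using Rnz Rdeg by (subst degree_mult_eq) (auto simp: degree_power_eq)
  have Slc: "coeff S (2 * k) = - 1"
    using Sdeg lead_coeff_mult[of "[:d, 0, - 1:]" "R\<^sup>2"] Rlc
    by (simp add: S_def lead_coeff_power)
  have S0: "sym_functional (moment M) S = 0"
  proof (rule M(3))
    fix y assume "poly P y = 0"
    then have "poly [:d, 0, - 1:] y = 0 \<or> poly R y = 0" unfolding R by (auto simp: algebra_simps)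
    then show "poly S y = 0" unfolding S_def by auto
  qed
  have eqM: "moment M k = m k - moment_gap m k + t * moment_gap m (k - 1)"
    using M(2)[of k] k by (simp add: m'_def)
  have eqMj: "moment M j = m j" if "j \<in> {1..<k}" for j
    using M(2)[of j] agree[OF that] that by simp
  show ?thesis unfolding m_plus_def t_def[symmetric]
  proof (rule Greatest_equality)
    show "m k - moment_gap m k + t * moment_gap m (k - 1) \<in> moment_fibre {0..d} m k"
      unfolding moment_fibre_def using M(1) eqM eqMj by force
    fix y assume "y \<in> moment_fibre {0..d} m k"
    then obtain M' where M': "M' \<in> moment_measures {0..d}" "y = moment M' k"
      "\<And>j. j \<in> {1..<k} \<Longrightarrow> moment M' j = m j" by (auto simp: moment_fibre_def)
    have "0 \<le> sym_functional (moment M') S"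
    proof (subst sym_functional_moment[OF M'(1)])
      have "poly S y = (d - y\<^sup>2) * (poly R y)\<^sup>2" for y
        by (simp add: S_def algebra_simps power2_eq_square)
      then have "even_part S x \<ge> 0" if "x \<in> {0..d}" for x
        using that by (simp add: even_part_def)
      then show "0 \<le> (\<integral>x. even_part S x \<partial>M')"
        using space_moment_measure[OF M'(1)] by (intro Bochner_Integration.integral_nonneg) auto
    qed auto
    moreover have "sym_functional (moment M') S - sym_functional (moment M) S = - (moment M' k - moment M k)"
      using sym_functional_cong_top[of S k "moment M'" "moment M"] Sdeg Slc k M'(3) eqMj by simp
    ultimately show "y \<le> m k - moment_gap m k + t * moment_gap m (k - 1)"
      using S0 eqM M'(2) by simp
  qed
qed

lemma gap_ratio_cong:
  assumes "\<And>j. j \<in> {1..k} \<Longrightarrow> m j = m' j"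
  shows "gap_ratio m k = gap_ratio m' k"
proof -
  have "moment_gap m k = moment_gap m' k" using assms by (rule moment_gap_cong)
  moreover have "moment_gap m (k - 1) = moment_gap m' (k - 1)" by (rule moment_gap_cong) (use assms in auto)
  ultimately show ?thesis by (simp add: gap_ratio_def)
qed

lemma moment_gap_pred_pos:
  assumes "\<And>j. j \<in> {1..<k} \<Longrightarrow> moment_gap m j > 0"
  shows "moment_gap m (k - 1) > 0"
proof (cases "k \<le> 1")
  case True
  then have "k - 1 = 0" by simp
  then show ?thesis by simp
next
  case False
  then show ?thesis by (intro assms) auto
qed

lemma moment_gap_eq_prod_gap_ratio:
  assumes "\<And>j. j \<in> {1..k} \<Longrightarrow> gap_ratio m j > 0"
  shows "moment_gap m k = (\<Prod>j=1..k. gap_ratio m j)"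
  using assms
proof (induction k)
  case (Suc k)
  then have h: "moment_gap m k = (\<Prod>j=1..k. gap_ratio m j)" by auto
  have "(\<Prod>j=1..k. gap_ratio m j) > 0" using Suc.prems by (intro prod_pos) auto
  then have "moment_gap m k > 0" unfolding h .
  then have "moment_gap m (Suc k) = moment_gap m k * gap_ratio m (Suc k)" by (simp add: gap_ratio_def)
  then show ?case by (simp add: h)
qed simp

lemma moment_gap_pos_iff_gap_ratio_pos:
  "(\<forall>j\<in>{1..k}. moment_gap m j > 0) \<longleftrightarrow> (\<forall>j\<in>{1..k}. gap_ratio m j > 0)"
proof
  assume *: "\<forall>j\<in>{1..k}. moment_gap m j > 0"
  have "moment_gap m (j - 1) > 0" if "j \<in> {1..k}" for j
    using * that by (intro moment_gap_pred_pos) auto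
  with * show "\<forall>j\<in>{1..k}. gap_ratio m j > 0" by (auto simp: gap_ratio_def)
next
  assume *: "\<forall>j\<in>{1..k}. gap_ratio m j > 0"
  show "\<forall>j\<in>{1..k}. moment_gap m j > 0"
  proof
    fix j assume j: "j \<in> {1..k}"
    have "moment_gap m j = (\<Prod>i=1..j. gap_ratio m i)" using * j by (intro moment_gap_eq_prod_gap_ratio) auto
    also have "\<dots> > 0" using * j by (intro prod_pos) auto
    finally show "moment_gap m j > 0" .
  qed
qed

text \<open>Since all gaps before the first nonpositive one are positive, that gap still
  measures the distance of \<open>m k\<close> from its lower bound, and its sign makes a factor of both
  densities vanish.\<close>

lemma first_nonpos_gap:
  assumes "\<not> (\<forall>j\<in>{1..n}. moment_gap m j > 0)"
  obtains k where "k \<in> {1..n}" "moment_gap m k \<le> 0" "\<And>j. j \<in> {1..<k} \<Longrightarrow> moment_gap m j > 0" "gap_ratio m k \<le> 0"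
proof -
  define k where "k = (LEAST k. k \<in> {1..n} \<and> moment_gap m k \<le> 0)"
  have "\<exists>k. k \<in> {1..n} \<and> moment_gap m k \<le> 0" using assms by force
  then have k: "k \<in> {1..n} \<and> moment_gap m k \<le> 0" unfolding k_def by (rule LeastI_ex)
  have less: "moment_gap m j > 0" if "j \<in> {1..<k}" for j
    using not_less_Least[of j "\<lambda>k. k \<in> {1..n} \<and> moment_gap m k \<le> 0"] that k unfolding k_def[symmetric] by force
  have "moment_gap m (k - 1) > 0" using less by (rule moment_gap_pred_pos)
  then have "gap_ratio m k \<le> 0" using k by (simp add: gap_ratio_def divide_nonpos_pos)
  with k less that show thesis by blast
qed

lemma m_minus_unbounded:
  assumes "k \<ge> 1" "\<And>j. j \<in> {1..<k} \<Longrightarrow> moment_gap m j > 0"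
  shows "m_minus {0..} m k = m k - moment_gap m k"
  using assms by (intro m_minus_eq) auto

lemma z_coord_eq_gap_ratio:
  assumes "k \<ge> 1" "\<And>j. j \<in> {1..<k} \<Longrightarrow> moment_gap m j > 0"
  shows "z_coord m k = gap_ratio m k"
proof (cases "k = 1")
  case True
  then show ?thesis using m_minus_unbounded[of k m] by (simp add: z_coord_def gap_ratio_def)
next
  case False
  then have "m_minus {0..} m (k - 1) = m (k - 1) - moment_gap m (k - 1)"
    using assms by (intro m_minus_unbounded) auto
  then show ?thesis using m_minus_unbounded[OF assms] False by (simp add: z_coord_def gap_ratio_def)
qed

section \<open>Limits of the one-dimensional factors\<close>

lemma nn_integral_gamma_density:
  fixes a b :: real
  assumes a: "a > 0" and b: "b > 0"
  shows "(\<integral>\<^sup>+u. ennreal (indicator {0..} u * (u powr (a - 1) * exp (- b * u))) \<partial>lborel)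
    = ennreal (Gamma a / b powr a)" (is "?I = _")
proof -
  have "ennreal (Gamma a) = ennreal b *
      (\<integral>\<^sup>+u. ennreal (indicator {0..} (b * u) * (b * u) powr (a - 1) / exp (b * u)) \<partial>lborel)"
    using a b nn_integral_real_affine[of "\<lambda>t. ennreal (indicator {0..} t * t powr (a - 1) / exp t)" b 0]
    by (simp add: Gamma_conv_nn_integral_real)
  also have "(\<integral>\<^sup>+u. ennreal (indicator {0..} (b * u) * (b * u) powr (a - 1) / exp (b * u)) \<partial>lborel)
      = (\<integral>\<^sup>+u. ennreal (b powr (a - 1)) *
          ennreal (indicator {0..} u * (u powr (a - 1) * exp (- b * u))) \<partial>lborel)"
    using b by (intro nn_integral_cong)
      (auto simp: indicator_def powr_mult exp_minus field_simps zero_le_mult_iff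
        ennreal_mult[symmetric])
  also have "\<dots> = ennreal (b powr (a - 1)) * ?I" by (rule nn_integral_cmult) simp
  also have "ennreal b * \<dots> = ennreal (b powr a) * ?I"
    using b by (simp add: mult.assoc[symmetric] ennreal_mult[symmetric] powr_diff)
  finally have 1: "ennreal (Gamma a) = ennreal (b powr a) * ?I" .
  have "?I = ennreal (1 / b powr a) * (ennreal (b powr a) * ?I)"
    using b by (simp add: mult.assoc[symmetric] ennreal_mult[symmetric])
  also have "\<dots> = ennreal (Gamma a / b powr a)"
    unfolding 1[symmetric] using b a by (simp add: ennreal_mult[symmetric])
  finally show ?thesis .
qed

lemma gamma_density_integral:
  fixes a b :: real
  assumes a: "a > 0" and b: "b > 0"
  shows "integrable lborel (\<lambda>u. indicator {0..} u * (u powr (a - 1) * exp (- b * u)))"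
    and "(\<integral>u. indicator {0..} u * (u powr (a - 1) * exp (- b * u)) \<partial>lborel) = Gamma a / b powr a"
proof -
  have "has_bochner_integral lborel
    (\<lambda>u. indicator {0..} u * (u powr (a - 1) * exp (- b * u))) (Gamma a / b powr a)"
  proof (rule has_bochner_integral_nn_integral)
    show "0 \<le> Gamma a / b powr a" using Gamma_real_pos[OF a] by simp
  qed (use nn_integral_gamma_density[OF a b] in simp_all)
  then show "integrable lborel (\<lambda>u. indicator {0..} u * (u powr (a - 1) * exp (- b * u)))"
    "(\<integral>u. indicator {0..} u * (u powr (a - 1) * exp (- b * u)) \<partial>lborel) = Gamma a / b powr a"
    by (simp_all add: has_bochner_integral_iff)
qed

lemma tendsto_one_minus_powr:
  fixes t e :: "'a \<Rightarrow> real"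
  assumes t: "filterlim t at_top F" and e: "((\<lambda>d. e d / t d) \<longlongrightarrow> \<delta>) F"
  shows "((\<lambda>d. (1 - z / t d) powr e d) \<longlongrightarrow> exp (- \<delta> * z)) F"
proof -
  have "((\<lambda>d. (1 + - z / t d) powr t d) \<longlongrightarrow> exp (- z)) F"
    using filterlim_compose[OF tendsto_exp_limit_at_top[of "- z"] t] by simp
  then have "((\<lambda>d. ((1 + - z / t d) powr t d) powr (e d / t d)) \<longlongrightarrow> exp (- z) powr \<delta>) F"
    using e by (intro tendsto_powr) auto
  moreover have "\<forall>\<^sub>F d in F. ((1 + - z / t d) powr t d) powr (e d / t d) = (1 - z / t d) powr e d"
    using filterlim_at_top_dense[THEN iffD1, OF t, rule_format, of 0]
    by eventually_elim (simp add: powr_powr)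
  ultimately have "((\<lambda>d. (1 - z / t d) powr e d) \<longlongrightarrow> exp (- z) powr \<delta>) F"
    by (rule Lim_transform_eventually)
  then show ?thesis by (simp add: powr_def mult.commute)
qed

text \<open>After the substitution \<open>x = u / d\<close> the powers of \<open>d\<close> cancel and the integrand tends
  to a gamma density; \<open>1 - v \<le> exp (- v)\<close> supplies the dominating function.\<close>

lemma scaled_Beta_tendsto_Gamma:
  fixes s e :: "real \<Rightarrow> real"
  assumes s: "(s \<longlongrightarrow> s0) at_top" "s0 > 0" and e: "((\<lambda>d. e d / d) \<longlongrightarrow> \<delta>) at_top" "\<delta> > 0"
  shows "((\<lambda>d. d powr s d * (LBINT x:{0..1}. x powr (s d - 1) * (1 - x) powr e d))
    \<longlongrightarrow> Gamma s0 / \<delta> powr s0) at_top"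
proof -
  define F where "F d u = indicator {0..d} u * (u powr (s d - 1) * (1 - u / d) powr e d)" for d u :: real
  define f where "f u = indicator {0..} u * (u powr (s0 - 1) * exp (- \<delta> * u))" for u :: real
  \<comment> \<open>the two powers bound \<open>u powr (s d - 1)\<close> for small and for large \<open>u\<close>\<close>
  define w where "w u = indicator {0..} u * (u powr (s0 / 2 - 1) * exp (- (\<delta> / 2) * u))
    + indicator {0..} u * (u powr (s0 + 1 - 1) * exp (- (\<delta> / 2) * u))" for u :: real
  have "((\<lambda>d. \<integral>u. F d u \<partial>lborel) \<longlongrightarrow> (\<integral>u. f u \<partial>lborel)) at_top"
  proof (rule integral_dominated_convergence_at_top)
    show "integrable lborel w"
      unfolding w_def using s(2) e(2)
      by (intro Bochner_Integration.integrable_add gamma_density_integral(1)) auto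
    show "f \<in> borel_measurable lborel" unfolding f_def by measurable
    show "F d \<in> borel_measurable lborel" for d unfolding F_def by measurable
    have "\<forall>\<^sub>F d in at_top. s d > s0 / 2" "\<forall>\<^sub>F d in at_top. s d < s0 + 1"
      using s by (intro order_tendstoD[OF s(1)]; simp)+
    moreover have "\<forall>\<^sub>F d in at_top. e d / d > \<delta> / 2" using e by (intro order_tendstoD[OF e(1)]) auto
    ultimately show "\<forall>\<^sub>F d in at_top. AE u in lborel. norm (F d u) \<le> w u"
      using eventually_gt_at_top[of 0]
    proof eventually_elim
      case (elim d)
      have "norm (F d u) \<le> w u" for u
      proof (cases "0 < u \<and> u < d")
        case True
        have "u powr (s d - 1) \<le> u powr (s0 / 2 - 1) + u powr (s0 + 1 - 1)"
        proof (cases "u \<ge> 1")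
          case True
          then have "u powr (s d - 1) \<le> u powr (s0 + 1 - 1)" using elim by (intro powr_mono) auto
          then show ?thesis by (simp add: add_increasing)
        next
          case False
          then have "u powr (s d - 1) \<le> u powr (s0 / 2 - 1)"
            using elim \<open>0 < u \<and> u < d\<close> by (intro powr_mono') auto
          then show ?thesis by (simp add: add_increasing2)
        qed
        moreover have "(1 - u / d) powr e d \<le> exp (- (\<delta> / 2) * u)"
        proof -
          have "\<delta> / 2 * d < e d" using elim(3,4) by (simp only: pos_less_divide_eq)
          moreover have "0 < \<delta> / 2 * d" using elim e(2) by simp
          ultimately have e0: "e d > 0" by linarith
          have "(1 - u / d) powr e d \<le> exp (- (u / d)) powr e d"
            using True e0 exp_ge_add_one_self[of "- (u / d)"] by (intro powr_mono2) auto
          also have "\<dots> = exp (- (u / d * e d))" by (simp add: powr_def mult.commute)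
          also have "\<dots> \<le> exp (- (\<delta> / 2) * u)"
          proof -
            have "\<delta> / 2 * u \<le> e d / d * u" using elim True by (intro mult_right_mono) auto
            then show ?thesis by (simp add: mult.commute)
          qed
          finally show ?thesis .
        qed
        ultimately have "u powr (s d - 1) * (1 - u / d) powr e d
            \<le> (u powr (s0 / 2 - 1) + u powr (s0 + 1 - 1)) * exp (- (\<delta> / 2) * u)"
          by (intro mult_mono) auto
        then show ?thesis using True by (simp add: F_def w_def algebra_simps)
      next
        case False
        then have "F d u = 0" using elim by (auto simp: F_def indicator_def)
        moreover have "0 \<le> w u" by (simp add: w_def)
        ultimately show ?thesis by simp
      qed
      then show ?case by simp
    qed
    show "AE u in lborel. ((\<lambda>d. F d u) \<longlongrightarrow> f u) at_top"
    proof (rule AE_I2)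
      fix u :: real
      show "((\<lambda>d. F d u) \<longlongrightarrow> f u) at_top"
      proof (cases "u > 0")
        case True
        have "((\<lambda>d. u powr (s d - 1) * (1 - u / d) powr e d) \<longlongrightarrow> u powr (s0 - 1) * exp (- \<delta> * u)) at_top"
          using True s e by (intro tendsto_intros tendsto_one_minus_powr filterlim_ident) auto
        then have "((\<lambda>d. F d u) \<longlongrightarrow> u powr (s0 - 1) * exp (- \<delta> * u)) at_top"
        proof (rule Lim_transform_eventually)
          show "\<forall>\<^sub>F d in at_top. u powr (s d - 1) * (1 - u / d) powr e d = F d u"
            using eventually_ge_at_top[of u] by eventually_elim (use True in \<open>simp add: F_def\<close>)
        qed
        then show ?thesis using True by (simp add: f_def)
      next
        case False
        then have "F d u = 0" for d by (auto simp: F_def indicator_def)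
        moreover have "f u = 0" using False by (auto simp: f_def indicator_def)
        ultimately show ?thesis by simp
      qed
    qed
  qed
  moreover have "(\<integral>u. f u \<partial>lborel) = Gamma s0 / \<delta> powr s0"
    unfolding f_def using s(2) e(2)
    by (intro gamma_density_integral(2))
  moreover have "\<forall>\<^sub>F d in at_top. (\<integral>u. F d u \<partial>lborel)
      = d powr s d * (LBINT x:{0..1}. x powr (s d - 1) * (1 - x) powr e d)"
    using eventually_gt_at_top[of 0]
  proof eventually_elim
    case (elim d)
    have "(LBINT x:{0..1}. x powr (s d - 1) * (1 - x) powr e d)
        = \<bar>1 / d\<bar> *\<^sub>R (\<integral>u. indicator {0..1} (0 + 1 / d * u)
            *\<^sub>R ((0 + 1 / d * u) powr (s d - 1) * (1 - (0 + 1 / d * u)) powr e d) \<partial>lborel)"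
      unfolding set_lebesgue_integral_def using elim by (intro lborel_integral_real_affine) auto
    also have "\<dots> = 1 / d * (\<integral>u. d powr (1 - s d) * F d u \<partial>lborel)"
    proof -
      have "indicator {0..1} (0 + 1 / d * u)
            *\<^sub>R ((0 + 1 / d * u) powr (s d - 1) * (1 - (0 + 1 / d * u)) powr e d)
          = d powr (1 - s d) * F d u" for u
      proof (cases "0 \<le> u \<and> u \<le> d")
        case True
        have "(u / d) powr (s d - 1) = d powr (1 - s d) * u powr (s d - 1)"
          using True elim by (simp add: powr_divide powr_diff field_simps)
        then show ?thesis using True elim by (simp add: F_def)
      next
        case False
        then have "1 / d * u \<notin> {0..1}" using elim by (auto simp: field_simps)
        then show ?thesis using False by (auto simp: F_def)
      qed
      then show ?thesis using elim by simp
    qed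
    also have "\<dots> = d powr (- s d) * (\<integral>u. F d u \<partial>lborel)"
      using elim by (simp add: powr_diff powr_minus field_simps)
    finally show ?case using elim by (simp add: powr_minus)
  qed
  ultimately show ?thesis by (simp only:) (rule Lim_transform_eventually)
qed

text \<open>The limit of one factor of the density, with \<open>t d\<close> in the role of the relative
  length of the moment range: the power of \<open>d\<close> compensates the decay of \<open>z / t d\<close>.\<close>

lemma factor_limit:
  fixes t g e :: "real \<Rightarrow> real"
  assumes t: "((\<lambda>d. t d / d) \<longlongrightarrow> 1) at_top" and z: "z > 0"
    and g: "(g \<longlongrightarrow> \<gamma>) at_top" and e: "((\<lambda>d. e d / d) \<longlongrightarrow> \<delta>) at_top"
  shows "((\<lambda>d. (z / t d) powr g d * (1 - z / t d) powr e d * d powr g d)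
    \<longlongrightarrow> z powr \<gamma> * exp (- \<delta> * z)) at_top"
proof -
  have t_top: "filterlim t at_top at_top"
  proof -
    have "filterlim (\<lambda>d. t d / d * d) at_top at_top"
      by (rule filterlim_tendsto_pos_mult_at_top[OF t]) (auto simp: filterlim_ident)
    moreover have "\<forall>\<^sub>F d in at_top. t d / d * d = t d"
      using eventually_gt_at_top[of 0] by eventually_elim simp
    ultimately show ?thesis by (simp only: filterlim_cong[OF refl refl])
  qed
  have dt: "((\<lambda>d. d / t d) \<longlongrightarrow> 1) at_top"
    using tendsto_inverse[OF t] by simp
  have ev: "\<forall>\<^sub>F d in at_top. d > 0 \<and> t d > 0"
    using eventually_gt_at_top[of 0] t_top by (auto simp: filterlim_at_top_dense eventually_conj_iff)
  have "((\<lambda>d. (e d / d) * (d / t d)) \<longlongrightarrow> \<delta> * 1) at_top" by (intro tendsto_mult e dt)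
  moreover have "\<forall>\<^sub>F d in at_top. (e d / d) * (d / t d) = e d / t d"
    using ev by eventually_elim simp
  ultimately have et: "((\<lambda>d. e d / t d) \<longlongrightarrow> \<delta>) at_top"
    unfolding mult_1_right by (rule Lim_transform_eventually)
  have "((\<lambda>d. z * (d / t d)) \<longlongrightarrow> z * 1) at_top" by (intro tendsto_mult tendsto_const dt)
  then have "((\<lambda>d. (z * (d / t d)) powr g d * (1 - z / t d) powr e d)
      \<longlongrightarrow> z powr \<gamma> * exp (- \<delta> * z)) at_top"
    using z by (intro tendsto_mult tendsto_powr tendsto_one_minus_powr t_top et g) auto
  moreover have "\<forall>\<^sub>F d in at_top. (z * (d / t d)) powr g d * (1 - z / t d) powr e d
      = (z / t d) powr g d * (1 - z / t d) powr e d * d powr g d"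
    using ev
  proof eventually_elim
    case (elim d)
    have "(z * (d / t d)) powr g d = (z / t d * d) powr g d" by simp
    also have "\<dots> = (z / t d) powr g d * d powr g d" using elim z by (intro powr_mult)
    finally show ?case by simp
  qed
  ultimately show ?thesis by (rule Lim_transform_eventually)
qed

section \<open>The limit is a probability density\<close>

definition gamma_kernel :: "real \<Rightarrow> real \<Rightarrow> real \<Rightarrow> real" where
  "gamma_kernel a b z = z powr a * exp (- b * z) * of_bool (z > 0)"

lemma g_dens_eq:
  "g_dens n \<gamma> \<delta> m = c_unbounded n \<gamma> \<delta> * (\<Prod>k=1..n. gamma_kernel (\<gamma> k) (\<delta> k) (gap_ratio m k))"
proof (cases "\<forall>j\<in>{1..n}. moment_gap m j > 0")
  case True
  then have "z_coord m k = gap_ratio m k" if "k \<in> {1..n}" for k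
    using that by (intro z_coord_eq_gap_ratio) auto
  then show ?thesis by (simp add: g_dens_def gamma_kernel_def)
next
  case False
  then obtain k where k: "k \<in> {1..n}" "\<And>j. j \<in> {1..<k} \<Longrightarrow> moment_gap m j > 0" "gap_ratio m k \<le> 0"
    using first_nonpos_gap by blast
  have "z_coord m k \<le> 0" using z_coord_eq_gap_ratio[of k m] k by auto
  then have "(\<Prod>k=1..n. z_coord m k powr \<gamma> k * exp (- \<delta> k * z_coord m k) * of_bool (z_coord m k > 0)) = 0"
    using k(1) by (intro prod_zero) (auto intro!: bexI[of _ k])
  moreover have "(\<Prod>k=1..n. gamma_kernel (\<gamma> k) (\<delta> k) (gap_ratio m k)) = 0"
    using k by (intro prod_zero) (auto intro!: bexI[of _ k] simp: gamma_kernel_def)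
  ultimately show ?thesis unfolding g_dens_def by (rule arg_cong2[OF refl trans[OF _ sym]])
qed

lemma moment_gap_expand:
  "moment_gap m k = (\<Sum>i\<le>2*k. (\<Sum>u\<le>i. coeff (ortho m k) u * coeff (ortho m k) (i - u)) * sym_moment m i)"
proof -
  have "moment_gap m k = (\<Sum>i\<le>2*k. coeff ((ortho m k)\<^sup>2) i * sym_moment m i)"
    unfolding moment_gap_def by (intro sym_functional_eq_sum) simp
  then show ?thesis by (simp only: power2_eq_square coeff_mult)
qed

text \<open>One induction along the recurrence serves both for measurability and for
  continuity: a gap is obtained from the coordinates by ring operations and division by earlier
  gaps.\<close>

lemma moment_gap_closed:
  fixes Q :: "((nat \<Rightarrow> real) \<Rightarrow> real) \<Rightarrow> bool"
  assumes const: "\<And>c. Q (\<lambda>_. c)" and coord: "\<And>j. Q (\<lambda>m. m j)"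
    and add: "\<And>f g. Q f \<Longrightarrow> Q g \<Longrightarrow> Q (\<lambda>m. f m + g m)"
    and mult: "\<And>f g. Q f \<Longrightarrow> Q g \<Longrightarrow> Q (\<lambda>m. f m * g m)"
    and div: "\<And>f j. j < N \<Longrightarrow> Q f \<Longrightarrow> Q (\<lambda>m. f m / moment_gap m j)"
    and k: "k \<le> Suc N"
  shows "Q (\<lambda>m. moment_gap m k)"
proof -
  have sum: "Q (\<lambda>m. \<Sum>i\<le>K. f i m)" if "\<And>i. Q (f i)" for f and K :: nat
    by (induction K) (auto intro: that add)
  have sym: "Q (\<lambda>m. sym_moment m i)" for i
    by (cases "odd i"; cases "i = 0") (auto simp: sym_moment_def intro: const coord)
  have step: "Q (\<lambda>m. moment_gap m k)" if "\<And>i. Q (\<lambda>m. coeff (ortho m k) i)" for k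
    unfolding moment_gap_expand by (intro sum mult sym that)
  have "Q (\<lambda>m. coeff (ortho m k) i)" if "k \<le> Suc N" for i k
    using that
  proof (induction k arbitrary: i rule: less_induct)
    case (less k)
    consider "k = 0" | "k = 1" | l where "k = Suc (Suc l)"
      by (metis One_nat_def not0_implies_Suc)
    then show ?case
    proof cases
      case 3
      have X: "Q (\<lambda>m. coeff ([:0, 1:] * ortho m (Suc l)) i)"
        using less.IH[of "Suc l"] less.prems 3 by (cases i) (auto intro: const)
      have "Q (\<lambda>m. moment_gap m (Suc l))" using less.IH[of "Suc l"] less.prems 3 by (intro step) auto
      then have z: "Q (\<lambda>m. gap_ratio m (Suc l))"
        unfolding gap_ratio_def using less.prems 3 by (intro div) auto
      have "Q (\<lambda>m. coeff ([:0, 1:] * ortho m (Suc l)) i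
          + (- 1) * (gap_ratio m (Suc l) * coeff (ortho m l) i))"
        using less.IH[of l] less.prems 3 by (intro add mult const X z) auto
      then show ?thesis using ortho_rec[of "Suc l"] by (simp add: 3 del: ortho.simps mult_pCons_left)
    qed (auto intro: const)
  qed
  then show ?thesis using k by (intro step) auto
qed

lemma measurable_coordinate: "(\<lambda>m. m j) \<in> borel_measurable (Pi\<^sub>M I (\<lambda>_. lborel :: real measure))"
proof (cases "j \<in> I")
  case True
  from measurable_component_singleton[OF this, of "\<lambda>_. lborel :: real measure"]
  show ?thesis by simp
next
  case False
  then have "\<And>m. m \<in> space (Pi\<^sub>M I (\<lambda>_. lborel :: real measure)) \<Longrightarrow> m j = undefined"
    by (auto simp: space_PiM PiE_def extensional_def)
  then show ?thesis by (subst measurable_cong[where g = "\<lambda>_. undefined"]) auto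
qed

lemma measurable_moment_gap: "(\<lambda>m. moment_gap m k) \<in> borel_measurable (Pi\<^sub>M I (\<lambda>_. lborel))"
proof (induction k rule: less_induct)
  case (less k)
  show ?case
  proof (rule moment_gap_closed[where N = k])
    show "(\<lambda>m. f m / moment_gap m j) \<in> borel_measurable (Pi\<^sub>M I (\<lambda>_. lborel))"
      if "j < k" "f \<in> borel_measurable (Pi\<^sub>M I (\<lambda>_. lborel))" for f j
      using that less[of j] by measurable
  qed (auto intro: measurable_coordinate)
qed

lemma measurable_gap_ratio [measurable]: "(\<lambda>m. gap_ratio m k) \<in> borel_measurable (Pi\<^sub>M I (\<lambda>_. lborel))"
  unfolding gap_ratio_def by (intro borel_measurable_divide measurable_moment_gap)

lemma open_moment_gap_pos: "open {m. \<forall>j\<in>{1..n}. moment_gap m j > 0}"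
proof (induction n)
  case (Suc n)
  define U where "U = {m. \<forall>j\<in>{1..n}. moment_gap m j > 0}"
  have nz: "moment_gap m j \<noteq> 0" if "j < Suc n" "m \<in> U" for m j
  proof (cases "j = 0")
    case False
    then have "j \<in> {1..n}" using that by auto
    then have "moment_gap m j > 0" using that(2) by (simp add: U_def)
    then show ?thesis by simp
  qed simp
  have "continuous_on U (\<lambda>m. moment_gap m (Suc n))"
  proof (rule moment_gap_closed[where N = "Suc n"])
    show "continuous_on U (\<lambda>m. f m / moment_gap m j)" if "j < Suc n" "continuous_on U f"
      for f :: "(nat \<Rightarrow> real) \<Rightarrow> real" and j
    proof -
      have "continuous_on U (\<lambda>m. moment_gap m j)" using that(1)
      proof (induction j rule: less_induct)
        case (less j)
        show ?case
        proof (rule moment_gap_closed[where N = j])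
          fix f :: "(nat \<Rightarrow> real) \<Rightarrow> real" and i assume i: "i < j" "continuous_on U f"
          have "moment_gap m i \<noteq> 0" if "m \<in> U" for m
            using i less.prems by (intro nz that) auto
          then show "continuous_on U (\<lambda>m. f m / moment_gap m i)"
            using i less by (intro continuous_on_divide) auto
        qed (auto intro!: continuous_intros continuous_on_product_coordinates[THEN continuous_on_subset])
      qed
      moreover have "moment_gap m j \<noteq> 0" if "m \<in> U" for m
        using nz[OF \<open>j < Suc n\<close> that] .
      ultimately show ?thesis using that by (intro continuous_on_divide) auto
    qed
  qed (auto intro!: continuous_intros continuous_on_product_coordinates[THEN continuous_on_subset])
  then have "open ((\<lambda>m. moment_gap m (Suc n)) -` {0<..} \<inter> U)"
    using Suc.IH unfolding U_def[symmetric] by (simp add: continuous_on_open_vimage)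
  also have "(\<lambda>m. moment_gap m (Suc n)) -` {0<..} \<inter> U = {m. \<forall>j\<in>{1..Suc n}. moment_gap m j > 0}"
    by (auto simp: U_def le_Suc_eq)
  finally show ?case .
qed simp

text \<open>Positivity of the gaps is an open condition, and each point that satisfies it is
  represented by the quadrature measure with one node more than there are moments.\<close>

lemma moment_gap_pos_interior:
  assumes "m \<in> space (lebesgue_n n)" "\<And>j. j \<in> {1..n} \<Longrightarrow> moment_gap m j > 0"
  shows "m \<in> euclidean_n n interior_of moment_space n {0..}"
proof -
  define S where "S = {m \<in> topspace (euclidean_n n). m \<in> {m. \<forall>j\<in>{1..n}. moment_gap m j > 0}}"
  have "continuous_map (euclidean_n n) (product_topology (\<lambda>_. euclideanreal) UNIV) (\<lambda>m. m)"
  proof (subst continuous_map_componentwise_UNIV, intro allI)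
    show "continuous_map (euclidean_n n) euclideanreal (\<lambda>m. m k)" for k
    proof (cases "k \<in> {1..n}")
      case False
      then have eq: "undefined = m k" if "m \<in> topspace (euclidean_n n)" for m
        using that by (auto simp: PiE_def extensional_def)
      have "continuous_map (euclidean_n n) euclideanreal (\<lambda>_. undefined)" by simp
      from continuous_map_eq[OF this eq] show ?thesis .
    qed (intro continuous_map_product_projection)
  qed
  moreover have "openin (product_topology (\<lambda>_. euclideanreal) UNIV) {m. \<forall>j\<in>{1..n}. moment_gap m j > 0}"
    unfolding euclidean_product_topology open_openin[symmetric] by (rule open_moment_gap_pos)
  ultimately have "openin (euclidean_n n) S"
    unfolding S_def by (rule openin_continuous_map_preimage)
  moreover have "m \<in> S" using assms by (auto simp: S_def space_PiM)
  moreover have "S \<subseteq> moment_space n {0..}"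
  proof
    fix x assume x: "x \<in> S"
    have "\<And>j. j \<in> {1..<Suc n} \<Longrightarrow> moment_gap x j > 0" using x by (auto simp: S_def)
    then obtain M where M: "M \<in> moment_measures {0..}" "\<And>j. j \<in> {1..<Suc n} \<Longrightarrow> moment M j = x j"
      by (rule gauss_moment_measure[of "Suc n" x "{0..}"]) auto
    have "x = (\<lambda>k\<in>{1..n}. moment M k)"
      using x M(2) by (auto simp: S_def PiE_def extensional_def fun_eq_iff)
    then show "x \<in> moment_space n {0..}" unfolding moment_space_def using M(1) by blast
  qed
  ultimately show ?thesis unfolding interior_of_def by blast
qed

lemma nn_integral_gamma_kernel:
  assumes "a > - 1" "b > 0" "h > 0"
  shows "(\<integral>\<^sup>+y. ennreal (gamma_kernel a b ((y - c) / h)) \<partial>lborel)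
    = ennreal (h * (Gamma (a + 1) / b powr (a + 1)))"
proof -
  have [measurable]: "gamma_kernel a b \<in> borel_measurable borel"
    unfolding gamma_kernel_def by measurable
  have "(\<integral>\<^sup>+y. ennreal (gamma_kernel a b ((y - c) / h)) \<partial>lborel)
      = ennreal h * (\<integral>\<^sup>+u. ennreal (gamma_kernel a b u) \<partial>lborel)"
    using assms nn_integral_real_affine[of "\<lambda>y. ennreal (gamma_kernel a b ((y - c) / h))" h c] by simp
  also have "(\<integral>\<^sup>+u. ennreal (gamma_kernel a b u) \<partial>lborel)
      = (\<integral>\<^sup>+u. ennreal (indicator {0..} u * (u powr (a + 1 - 1) * exp (- b * u))) \<partial>lborel)"
    by (intro nn_integral_cong) (auto simp: gamma_kernel_def indicator_def)
  also have "\<dots> = ennreal (Gamma (a + 1) / b powr (a + 1))"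
    using assms by (intro nn_integral_gamma_density) auto
  finally show ?thesis using assms by (simp add: ennreal_mult'[symmetric])
qed

text \<open>Integrate over the last moment first. It is an affine function of the last
  coordinate with slope \<open>moment_gap m (n - 1)\<close>, the product of all earlier coordinates; absorbing
  that product raises each of the remaining exponents \<open>\<gamma> k\<close> by 1. This is the triangular Jacobian,
  taken one row at a time.\<close>

lemma nn_integral_prod_gamma_kernel:
  assumes "\<And>k. k \<in> {1..n} \<Longrightarrow> \<gamma> k > - 1" "\<And>k. k \<in> {1..n} \<Longrightarrow> \<delta> k > 0"
  shows "(\<integral>\<^sup>+m. ennreal (\<Prod>k=1..n. gamma_kernel (\<gamma> k) (\<delta> k) (gap_ratio m k)) \<partial>lebesgue_n n)
    = ennreal (\<Prod>k=1..n. Gamma (\<gamma> k + real n - real k + 1) / \<delta> k powr (\<gamma> k + real n - real k + 1))"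
  using assms
proof (induction n arbitrary: \<gamma>)
  case 0
  show ?case by (simp add: space_PiM_empty)
next
  case (Suc n)
  interpret product_sigma_finite "\<lambda>_::nat. lborel :: real measure" ..
  define G where "G = Gamma (\<gamma> (Suc n) + 1) / \<delta> (Suc n) powr (\<gamma> (Suc n) + 1)"
  define K where "K m = (\<Prod>k=1..n. gamma_kernel (\<gamma> k) (\<delta> k) (gap_ratio m k))" for m
  define K' where "K' m = (\<Prod>k=1..n. gamma_kernel (\<gamma> k + 1) (\<delta> k) (gap_ratio m k))" for m
  have [measurable]: "gamma_kernel a b \<in> borel_measurable borel" for a b
    unfolding gamma_kernel_def by measurable
  have kernel_nonneg: "0 \<le> gamma_kernel a b z" for a b z by (simp add: gamma_kernel_def)
  have G: "G > 0" unfolding G_def using Suc.prems[of "Suc n"] by (intro divide_pos_pos Gamma_real_pos) auto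
  have inner: "(\<integral>\<^sup>+y. ennreal (\<Prod>k=1..Suc n. gamma_kernel (\<gamma> k) (\<delta> k) (gap_ratio (x(Suc n := y)) k)) \<partial>lborel)
      = ennreal G * ennreal (K' x)" for x
  proof -
    define c where "c = x (Suc n) - moment_gap x (Suc n)"
    have h: "moment_gap (x(Suc n := y)) n = moment_gap x n" for y by (intro moment_gap_cong) auto
    have "gap_ratio (x(Suc n := y)) k = gap_ratio x k" if "k \<in> {1..n}" for k y
      using that by (intro gap_ratio_cong) auto
    moreover have "gap_ratio (x(Suc n := y)) (Suc n) = (y - c) / moment_gap x n" for y
      using moment_gap_diff[of "Suc n" "x(Suc n := y)" x] h by (simp add: gap_ratio_def c_def)
    ultimately have eq: "(\<Prod>k=1..Suc n. gamma_kernel (\<gamma> k) (\<delta> k) (gap_ratio (x(Suc n := y)) k))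
        = K x * gamma_kernel (\<gamma> (Suc n)) (\<delta> (Suc n)) ((y - c) / moment_gap x n)" for y
      by (simp add: K_def)
    show ?thesis
    proof (cases "\<forall>k\<in>{1..n}. gap_ratio x k > 0")
      case True
      then have hp: "moment_gap x n = (\<Prod>k=1..n. gap_ratio x k)" by (intro moment_gap_eq_prod_gap_ratio) auto
      have h0: "moment_gap x n > 0" unfolding hp using True by (intro prod_pos) auto
      have K': "K' x = K x * moment_gap x n"
        unfolding K'_def K_def hp prod.distrib[symmetric]
      proof (intro prod.cong refl)
        fix k assume "k \<in> {1..n}"
        then have "gap_ratio x k > 0" using True by blast
        then show "gamma_kernel (\<gamma> k + 1) (\<delta> k) (gap_ratio x k)
            = gamma_kernel (\<gamma> k) (\<delta> k) (gap_ratio x k) * gap_ratio x k"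
          by (simp add: gamma_kernel_def powr_add)
      qed
      have "(\<integral>\<^sup>+y. ennreal (K x * gamma_kernel (\<gamma> (Suc n)) (\<delta> (Suc n)) ((y - c) / moment_gap x n)) \<partial>lborel)
          = ennreal (K x) * (\<integral>\<^sup>+y. ennreal (gamma_kernel (\<gamma> (Suc n)) (\<delta> (Suc n)) ((y - c) / moment_gap x n)) \<partial>lborel)"
        by (subst nn_integral_cmult[symmetric])
          (auto simp: ennreal_mult[symmetric] kernel_nonneg K_def prod_nonneg)
      also have "\<dots> = ennreal (K x) * ennreal (moment_gap x n * G)"
        unfolding G_def using Suc.prems[of "Suc n"] h0 by (subst nn_integral_gamma_kernel) auto
      also have "\<dots> = ennreal G * ennreal (K' x)"
        unfolding K' using G h0
        by (simp add: ennreal_mult[symmetric] kernel_nonneg K_def prod_nonneg mult_ac)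
      finally show ?thesis unfolding eq .
    next
      case False
      then obtain k where "k \<in> {1..n}" "gap_ratio x k \<le> 0" by force
      then have "K x = 0" "K' x = 0"
        unfolding K_def K'_def by (auto intro!: prod_zero bexI[of _ k] simp: gamma_kernel_def)
      then show ?thesis unfolding eq by simp
    qed
  qed
  have "{1..Suc n} = insert (Suc n) {1..n}" by auto
  then have "(\<integral>\<^sup>+m. ennreal (\<Prod>k=1..Suc n. gamma_kernel (\<gamma> k) (\<delta> k) (gap_ratio m k)) \<partial>lebesgue_n (Suc n))
      = (\<integral>\<^sup>+x. (\<integral>\<^sup>+y. ennreal (\<Prod>k=1..Suc n. gamma_kernel (\<gamma> k) (\<delta> k) (gap_ratio (x(Suc n := y)) k)) \<partial>lborel)
          \<partial>lebesgue_n n)"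
    by (simp only:) (intro product_nn_integral_insert; measurable)
  also have "\<dots> = (\<integral>\<^sup>+x. ennreal G * ennreal (K' x) \<partial>lebesgue_n n)" unfolding inner ..
  also have "\<dots> = ennreal G * (\<integral>\<^sup>+x. ennreal (K' x) \<partial>lebesgue_n n)"
    unfolding K'_def by (intro nn_integral_cmult) measurable
  also have "(\<integral>\<^sup>+x. ennreal (K' x) \<partial>lebesgue_n n) = ennreal (\<Prod>k=1..n.
      Gamma (\<gamma> k + 1 + real n - real k + 1) / \<delta> k powr (\<gamma> k + 1 + real n - real k + 1))"
    unfolding K'_def using Suc.prems by (intro Suc.IH) force+
  also have "ennreal G * \<dots> = ennreal (\<Prod>k=1..Suc n.
      Gamma (\<gamma> k + real (Suc n) - real k + 1) / \<delta> k powr (\<gamma> k + real (Suc n) - real k + 1))"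
    using G by (simp add: ennreal_mult'[symmetric] G_def mult.commute add_ac)
  finally show ?case .
qed

lemma g_dens_density:
  assumes "\<And>k. k \<ge> 1 \<Longrightarrow> \<gamma> k > - 1" "\<And>k. k \<ge> 1 \<Longrightarrow> \<delta> k > 0"
  shows "density_on_moment_space n {0..} (g_dens n \<gamma> \<delta>)"
  unfolding density_on_moment_space_def
proof (intro conjI ballI)
  have [measurable]: "gamma_kernel a b \<in> borel_measurable borel" for a b
    unfolding gamma_kernel_def by measurable
  define C where "C = c_unbounded n \<gamma> \<delta>"
  define K where "K m = (\<Prod>k=1..n. gamma_kernel (\<gamma> k) (\<delta> k) (gap_ratio m k))" for m
  have g: "g_dens n \<gamma> \<delta> m = C * K m" for m by (simp add: C_def K_def g_dens_eq)
  have [measurable]: "K \<in> borel_measurable (lebesgue_n n)" unfolding K_def by measurable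
  have Gpos: "Gamma (\<gamma> k + real n - real k + 1) > 0" if "k \<in> {1..n}" for k
    using that assms(1)[of k] by (intro Gamma_real_pos) auto
  have \<delta>nz: "\<delta> k \<noteq> 0" if "k \<in> {1..n}" for k using assms(2)[of k] that by auto
  have C: "C > 0" unfolding C_def c_unbounded_def
    using Gpos \<delta>nz by (intro prod_pos ballI divide_pos_pos) auto
  have K: "K m \<ge> 0" for m by (auto simp: K_def gamma_kernel_def intro: prod_nonneg)
  show "g_dens n \<gamma> \<delta> \<in> borel_measurable (lebesgue_n n)" unfolding g[abs_def] by measurable
  show "0 \<le> g_dens n \<gamma> \<delta> m" for m using C K by (simp add: g)
  show "g_dens n \<gamma> \<delta> m = 0"
    if m: "m \<in> space (lebesgue_n n) - euclidean_n n interior_of moment_space n {0..}" for m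
  proof (rule ccontr)
    assume "g_dens n \<gamma> \<delta> m \<noteq> 0"
    then have "\<forall>k\<in>{1..n}. gap_ratio m k > 0" unfolding g K_def by (auto simp: gamma_kernel_def)
    then show False using moment_gap_pos_iff_gap_ratio_pos[of n m] moment_gap_pos_interior[of m n] m by auto
  qed
  have "(\<integral>\<^sup>+m. ennreal (g_dens n \<gamma> \<delta> m) \<partial>lebesgue_n n)
      = (\<integral>\<^sup>+m. ennreal C * ennreal (K m) \<partial>lebesgue_n n)"
    using C K by (simp add: g ennreal_mult)
  also have "\<dots> = ennreal C * (\<integral>\<^sup>+m. ennreal (K m) \<partial>lebesgue_n n)"
    by (intro nn_integral_cmult) measurable
  also have "\<dots> = ennreal (C * (\<Prod>k=1..n.
      Gamma (\<gamma> k + real n - real k + 1) / \<delta> k powr (\<gamma> k + real n - real k + 1)))"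
    unfolding K_def using assms C by (subst nn_integral_prod_gamma_kernel) (auto simp: ennreal_mult')
  also have "C * (\<Prod>k=1..n.
      Gamma (\<gamma> k + real n - real k + 1) / \<delta> k powr (\<gamma> k + real n - real k + 1)) = (\<Prod>k=1..n. 1)"
    unfolding C_def c_unbounded_def prod.distrib[symmetric]
  proof (intro prod.cong refl)
    fix k assume k: "k \<in> {1..n}"
    show "\<delta> k powr (\<gamma> k + real n - real k + 1) / Gamma (\<gamma> k + real n - real k + 1) *
      (Gamma (\<gamma> k + real n - real k + 1) / \<delta> k powr (\<gamma> k + real n - real k + 1)) = 1"
      using Gpos[OF k] \<delta>nz[OF k] by simp
  qed
  finally show "(\<integral>\<^sup>+m. ennreal (g_dens n \<gamma> \<delta> m) \<partial>lebesgue_n n) = 1" by simp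
qed

section \<open>Pointwise convergence\<close>

lemma eventually_ortho_pos:
  "\<forall>\<^sub>F d in at_top. \<forall>y\<ge>sqrt d. poly (ortho m k) y > 0"
proof -
  obtain b where b: "\<And>x. x \<ge> b \<Longrightarrow> 1 \<le> poly (ortho m k) x"
    using poly_pinfty_gt_lc[of "ortho m k"] by auto
  have "\<forall>\<^sub>F d in at_top. sqrt d \<ge> b"
    using sqrt_at_top by (simp add: filterlim_at_top)
  then show ?thesis
  proof eventually_elim
    case (elim d)
    show ?case
    proof (intro allI impI)
      fix y assume "sqrt d \<le> y"
      then have "1 \<le> poly (ortho m k) y" using elim by (intro b) auto
      then show "poly (ortho m k) y > 0" by simp
    qed
  qed
qed

lemma eventually_m_minus:
  assumes "k \<ge> 1" "\<And>j. j \<in> {1..<k} \<Longrightarrow> moment_gap m j > 0"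
  shows "\<forall>\<^sub>F d in at_top. m_minus {0..d} m k = m k - moment_gap m k"
  using eventually_ortho_pos[of m k] eventually_gt_at_top[of 0]
proof eventually_elim
  case (elim d)
  show ?case
  proof (rule m_minus_eq)
    fix y assume y: "poly (ortho m k) y = 0"
    then have "poly (ortho m k) (- y) = 0" by (simp add: poly_ortho_minus)
    with y elim have "y < sqrt d" "- y < sqrt d" by (metis less_irrefl not_le)+
    then have "\<bar>y\<bar>\<^sup>2 \<le> (sqrt d)\<^sup>2" by (intro power_mono) auto
    then show "y\<^sup>2 \<in> {0..d}" using elim by simp
  qed (use assms in auto)
qed

lemma eventually_m_plus:
  assumes "k \<ge> 1" "\<And>j. j \<in> {1..<k} \<Longrightarrow> moment_gap m j > 0"
  shows "\<forall>\<^sub>F d in at_top. m_plus {0..d} m k = m k - moment_gap m k + upper_ratio m k d * moment_gap m (k - 1)"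
  using eventually_ortho_pos[of m k] eventually_ortho_pos[of m "k - 1"] eventually_gt_at_top[of 0]
  by eventually_elim (rule m_plus_eq, use assms in auto)

text \<open>By the recurrence, each ratio is 1 minus a multiple of \<open>1 / y\<^sup>2\<close> divided by the
  preceding ratio.\<close>

lemma ortho_ratio_tendsto:
  "((\<lambda>y. poly (ortho m (Suc k)) y / (y * poly (ortho m k) y)) \<longlongrightarrow> 1) at_top"
proof (induction k)
  case 0
  have "\<forall>\<^sub>F y::real in at_top. 1 = y / y"
    using eventually_gt_at_top[of 0] by eventually_elim simp
  from Lim_transform_eventually[OF tendsto_const this] show ?case by simp
next
  case (Suc k)
  obtain b where b: "\<And>x. x \<ge> b \<Longrightarrow> 1 \<le> poly (ortho m (Suc k)) x"
    using poly_pinfty_gt_lc[of "ortho m (Suc k)"] by (auto simp del: ortho.simps)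
  have "((\<lambda>y. 1 - gap_ratio m (Suc k) * (1 / y\<^sup>2) / (poly (ortho m (Suc k)) y / (y * poly (ortho m k) y)))
      \<longlongrightarrow> 1 - gap_ratio m (Suc k) * 0 / 1) at_top"
  proof (intro tendsto_diff tendsto_divide tendsto_mult tendsto_const Suc.IH)
    show "((\<lambda>y::real. 1 / y\<^sup>2) \<longlongrightarrow> 0) at_top"
      by (rule real_tendsto_divide_at_top[OF tendsto_const])
        (auto intro: filterlim_pow_at_top filterlim_ident)
  qed auto
  moreover have "\<forall>\<^sub>F y in at_top.
      1 - gap_ratio m (Suc k) * (1 / y\<^sup>2) / (poly (ortho m (Suc k)) y / (y * poly (ortho m k) y))
      = poly (ortho m (Suc (Suc k))) y / (y * poly (ortho m (Suc k)) y)"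
    using eventually_gt_at_top[of 0] eventually_ge_at_top[of b]
  proof eventually_elim
    case (elim y)
    then have "poly (ortho m (Suc k)) y \<noteq> 0" using b[of y] by auto
    moreover have "poly (ortho m (Suc (Suc k))) y
        = y * poly (ortho m (Suc k)) y - gap_ratio m (Suc k) * poly (ortho m k) y"
      using ortho_rec[of "Suc k" m] by (simp del: ortho.simps)
    ultimately show ?case using elim
      by (simp del: ortho.simps add: diff_divide_distrib power2_eq_square)
  qed
  ultimately show ?case by (simp del: ortho.simps add: tendsto_cong)
qed

lemma upper_ratio_tendsto:
  assumes "k \<ge> 1"
  shows "((\<lambda>d. upper_ratio m k d / d) \<longlongrightarrow> 1) at_top"
proof -
  obtain l where k: "k = Suc l" using assms by (cases k) auto
  have "((\<lambda>d. poly (ortho m (Suc l)) (sqrt d) / (sqrt d * poly (ortho m l) (sqrt d))) \<longlongrightarrow> 1) at_top"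
    by (rule filterlim_compose[OF ortho_ratio_tendsto sqrt_at_top])
  moreover have "\<forall>\<^sub>F d in at_top. poly (ortho m (Suc l)) (sqrt d) / (sqrt d * poly (ortho m l) (sqrt d))
      = upper_ratio m k d / d"
    using eventually_gt_at_top[of 0]
  proof eventually_elim
    case (elim d)
    then have "d = sqrt d * sqrt d" "sqrt d \<noteq> 0" by auto
    then show ?case unfolding upper_ratio_def k
      by (metis (no_types, lifting) diff_Suc_1 divide_divide_eq_left mult.commute nonzero_mult_divide_mult_cancel_left)
  qed
  ultimately show ?thesis by (rule Lim_transform_eventually)
qed

lemma f_dens_tendsto_zero:
  assumes "\<not> (\<forall>j\<in>{1..n}. moment_gap m j > 0)"
  shows "((\<lambda>d. f_dens n d (\<gamma>d d) (\<delta>d d) m) \<longlongrightarrow> 0) at_top"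
proof -
  obtain k where k: "k \<in> {1..n}" "moment_gap m k \<le> 0" "\<And>j. j \<in> {1..<k} \<Longrightarrow> moment_gap m j > 0"
    using first_nonpos_gap[OF assms] by blast
  have "\<forall>\<^sub>F d in at_top. m_minus {0..d} m k = m k - moment_gap m k"
    using k by (intro eventually_m_minus) auto
  then have "\<forall>\<^sub>F d in at_top. 0 = f_dens n d (\<gamma>d d) (\<delta>d d) m"
  proof eventually_elim
    case (elim d)
    then have "\<not> m_minus {0..d} m k < m k" using k by simp
    then show ?case unfolding f_dens_def Let_def
      using k(1) by (auto intro!: bexI[of _ k])
  qed
  from Lim_transform_eventually[OF tendsto_const this] show ?thesis .
qed

lemma prod_power_descending: "(\<Prod>k=1..n. d ^ (n - k + 1)) = (d::real) ^ (n * (n + 1) div 2)"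
proof -
  have "(\<Prod>k=1..n. d ^ (n - k + 1)) = d ^ (\<Sum>k=1..n. n - k + 1)" by (simp add: power_sum)
  also have "(\<Sum>k=1..n. n - k + 1) = (\<Sum>k=1..n. k)"
    by (rule sum.reindex_bij_witness[of _ "\<lambda>k. n - k + 1" "\<lambda>k. n - k + 1"]) auto
  also have "\<dots> = n * (n + 1) div 2" using gauss_sum_from_Suc_0[of n, where 'a = nat] by simp
  finally show ?thesis .
qed

text \<open>For large \<open>d\<close> the factor of index \<open>k\<close> is a power of \<open>z / t\<close> times a power of
  \<open>1 - z / t\<close>, where \<open>z = gap_ratio m k\<close> and \<open>t = upper_ratio m k d\<close> grows like \<open>d\<close>. The
  normalising constant splits into one beta integral and \<open>n - k + 1\<close> powers of \<open>d\<close> for each \<open>k\<close>,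
  so the limit can be taken factor by factor.\<close>

lemma f_dens_tendsto_pos:
  fixes \<gamma>d \<delta>d :: "real \<Rightarrow> nat \<Rightarrow> real"
  assumes pos: "\<forall>j\<in>{1..n}. moment_gap m j > 0"
    and \<gamma>: "\<And>k. k \<ge> 1 \<Longrightarrow> ((\<lambda>d. \<gamma>d d k) \<longlongrightarrow> \<gamma> k) at_top" "\<And>k. k \<ge> 1 \<Longrightarrow> \<gamma> k > -1"
    and \<delta>: "\<And>k. k \<ge> 1 \<Longrightarrow> ((\<lambda>d. \<delta>d d k / d) \<longlongrightarrow> \<delta> k) at_top" "\<And>k. k \<ge> 1 \<Longrightarrow> \<delta> k > 0"
  shows "((\<lambda>d. f_dens n d (\<gamma>d d) (\<delta>d d) m) \<longlongrightarrow> g_dens n \<gamma> \<delta> m) at_top"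
proof -
  define z where "z k = gap_ratio m k" for k
  define t where "t k d = upper_ratio m k d" for k d
  define s where "s k d = \<gamma>d d k + real n - real k + 1" for k d
  define s0 where "s0 k = \<gamma> k + real n - real k + 1" for k
  \<comment> \<open>\<open>A\<close> collects the powers at the point \<open>m\<close> and \<open>d powr s k d * B k d\<close> the normalisation;
     the factor \<open>d powr \<gamma>d d k\<close>, put into both so that each converges, cancels\<close>
  define A where "A k d = (z k / t k d) powr \<gamma>d d k * (1 - z k / t k d) powr \<delta>d d k * d powr \<gamma>d d k" for k d
  define F where "F k d = (let a = m_minus {0..d} m k; b = m_plus {0..d} m k in
    ((m k - a) / (b - a)) powr \<gamma>d d k * ((b - m k) / (b - a)) powr \<delta>d d k
      * of_bool (a < m k \<and> m k < b))" for k d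
  define B where "B k d = (LBINT x:{0..1}. x powr (s k d - 1) * (1 - x) powr (real n - real k + \<delta>d d k))" for k d
  have zpos: "z k > 0" if "k \<in> {1..n}" for k
    using pos moment_gap_pos_iff_gap_ratio_pos[of n m] that by (auto simp: z_def)
  have s0pos: "s0 k > 0" if "k \<in> {1..n}" for k using \<gamma>(2)[of k] that by (auto simp: s0_def)
  have Alim: "(A k \<longlongrightarrow> z k powr \<gamma> k * exp (- \<delta> k * z k)) at_top" if "k \<in> {1..n}" for k
    unfolding A_def t_def using that zpos[OF that]
    by (intro factor_limit upper_ratio_tendsto \<gamma> \<delta>) auto
  have Blim: "((\<lambda>d. d powr s k d * B k d) \<longlongrightarrow> Gamma (s0 k) / \<delta> k powr s0 k) at_top" if "k \<in> {1..n}" for k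
    unfolding B_def
  proof (rule scaled_Beta_tendsto_Gamma)
    show "(s k \<longlongrightarrow> s0 k) at_top" unfolding s_def s0_def using that by (intro tendsto_intros \<gamma>) auto
    have "((\<lambda>d. (real n - real k) / d) \<longlongrightarrow> 0) at_top"
      by (rule real_tendsto_divide_at_top[OF tendsto_const filterlim_ident])
    from tendsto_add[OF this \<delta>(1)[of k]] that
    show "((\<lambda>d. (real n - real k + \<delta>d d k) / d) \<longlongrightarrow> \<delta> k) at_top"
      by (simp add: add_divide_distrib)
  qed (use that s0pos \<delta> in auto)
  have lim: "((\<lambda>d. \<Prod>k=1..n. A k d / (d powr s k d * B k d)) \<longlongrightarrow>
      (\<Prod>k=1..n. (z k powr \<gamma> k * exp (- \<delta> k * z k)) / (Gamma (s0 k) / \<delta> k powr s0 k))) at_top"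
  proof (intro tendsto_prod tendsto_divide Alim Blim)
    fix k assume k: "k \<in> {1..n}"
    show "Gamma (s0 k) / \<delta> k powr s0 k \<noteq> 0"
      using Gamma_real_pos[OF s0pos[OF k]] \<delta>(2)[of k] k by auto
  qed
  have g: "(\<Prod>k=1..n. (z k powr \<gamma> k * exp (- \<delta> k * z k)) / (Gamma (s0 k) / \<delta> k powr s0 k))
      = g_dens n \<gamma> \<delta> m"
    unfolding g_dens_eq c_unbounded_def prod.distrib[symmetric]
    by (intro prod.cong) (auto simp: gamma_kernel_def s0_def[symmetric] z_def[symmetric] zpos)
  have f: "\<forall>\<^sub>F d in at_top. (\<Prod>k=1..n. A k d / (d powr s k d * B k d)) = f_dens n d (\<gamma>d d) (\<delta>d d) m"
  proof -
    have ev: "\<forall>\<^sub>F d in at_top. \<forall>k\<in>{1..n}. m_minus {0..d} m k = m k - moment_gap m k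
        \<and> m_plus {0..d} m k = m k - moment_gap m k + t k d * moment_gap m (k - 1) \<and> t k d > z k"
    proof (intro eventually_ball_finite ballI eventually_conj)
      fix k assume k: "k \<in> {1..n}"
      show "\<forall>\<^sub>F d in at_top. m_minus {0..d} m k = m k - moment_gap m k"
        using pos k by (intro eventually_m_minus) auto
      show "\<forall>\<^sub>F d in at_top. m_plus {0..d} m k = m k - moment_gap m k + t k d * moment_gap m (k - 1)"
        unfolding t_def using pos k by (intro eventually_m_plus) auto
      have "\<forall>\<^sub>F d in at_top. t k d / d > 1 / 2"
        unfolding t_def using k by (intro order_tendstoD[OF upper_ratio_tendsto]) auto
      then show "\<forall>\<^sub>F d in at_top. t k d > z k"
        using eventually_gt_at_top[of 0] eventually_gt_at_top[of "2 * z k"]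
      proof eventually_elim
        case (elim d)
        then have "1 / 2 * d < t k d" by (simp only: pos_less_divide_eq)
        then show ?case using elim by simp
      qed
    qed simp
    show ?thesis using ev eventually_gt_at_top[of 0]
    proof eventually_elim
      case (elim d)
      have fac: "F k d = A k d / d powr \<gamma>d d k" if k: "k \<in> {1..n}" for k
      proof -
        have hk: "moment_gap m k > 0" using pos k by auto
        have h: "moment_gap m (k - 1) > 0" using pos k by (intro moment_gap_pred_pos) auto
        have zh: "moment_gap m k = z k * moment_gap m (k - 1)" using h by (simp add: z_def gap_ratio_def)
        have t: "t k d > z k" "t k d > 0" using elim k zpos[OF k] by force+
        define a where "a = m_minus {0..d} m k"
        define b where "b = m_plus {0..d} m k"
        have ab: "m k - a = z k * moment_gap m (k - 1)" "b - a = t k d * moment_gap m (k - 1)"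
          "b - m k = (t k d - z k) * moment_gap m (k - 1)"
          using bspec[OF elim(1) k] zh by (auto simp: a_def b_def algebra_simps)
        have "b - m k > 0" unfolding ab using t h by simp
        moreover have "m k - a > 0" using ab(1) zh hk by simp
        moreover have "(m k - a) / (b - a) = z k / t k d" unfolding ab using h by simp
        moreover have "(b - m k) / (b - a) = 1 - z k / t k d"
          unfolding ab using h t by (simp add: diff_divide_distrib)
        ultimately show ?thesis unfolding F_def Let_def a_def[symmetric] b_def[symmetric]
          using elim(2) by (simp add: A_def)
      qed
      have ds: "d powr s k d = d ^ (n - k + 1) * d powr \<gamma>d d k" if "k \<in> {1..n}" for k
      proof -
        have "s k d = real (n - k + 1) + \<gamma>d d k" using that by (simp add: s_def of_nat_diff)
        then show ?thesis using elim(2) by (simp add: powr_add powr_realpow del: of_nat_add)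
      qed
      have "c_compact n d (\<gamma>d d) (\<delta>d d) = inverse ((\<Prod>k=1..n. d ^ (n - k + 1)) * (\<Prod>k=1..n. B k d))"
        unfolding c_compact_def prod_power_descending B_def s_def by (simp add: algebra_simps)
      also have "\<dots> = (\<Prod>k=1..n. inverse (d ^ (n - k + 1) * B k d))"
        by (simp add: prod.distrib[symmetric] prod_inversef[symmetric])
      finally have c: "c_compact n d (\<gamma>d d) (\<delta>d d) = (\<Prod>k=1..n. inverse (d ^ (n - k + 1) * B k d))" .
      have "f_dens n d (\<gamma>d d) (\<delta>d d) m
          = (\<Prod>k=1..n. inverse (d ^ (n - k + 1) * B k d)) * (\<Prod>k=1..n. A k d / d powr \<gamma>d d k)"
        unfolding f_dens_def F_def[symmetric] c by (simp only: prod.cong[OF refl fac])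
      also have "\<dots> = (\<Prod>k=1..n. A k d / (d powr s k d * B k d))"
        unfolding prod.distrib[symmetric]
        by (intro prod.cong) (auto simp: ds field_simps)
      finally show ?case by simp
    qed
  qed
  show ?thesis using Lim_transform_eventually[OF lim f] unfolding g .
qed

theorem theorem2p2:
  fixes n :: nat
    and \<gamma>d \<delta>d :: "real \<Rightarrow> nat \<Rightarrow> real"
    and \<gamma> \<delta> :: "nat \<Rightarrow> real"
  assumes "n \<ge> 1"
    and "\<And>d k. d > 0 \<Longrightarrow> k \<ge> 1 \<Longrightarrow> \<gamma>d d k > -1"
    and "\<And>d k. d > 0 \<Longrightarrow> k \<ge> 1 \<Longrightarrow> \<delta>d d k > -1"
    and "\<And>k. k \<ge> 1 \<Longrightarrow> ((\<lambda>d. \<gamma>d d k) \<longlongrightarrow> \<gamma> k) at_top"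
    and "\<And>k. k \<ge> 1 \<Longrightarrow> \<gamma> k > -1"
    and "\<And>k. k \<ge> 1 \<Longrightarrow> ((\<lambda>d. \<delta>d d k / d) \<longlongrightarrow> \<delta> k) at_top"
    and "\<And>k. k \<ge> 1 \<Longrightarrow> \<delta> k > 0"
  shows "(\<forall>m\<in>space (lebesgue_n n).
            ((\<lambda>d. f_dens n d (\<gamma>d d) (\<delta>d d) m) \<longlongrightarrow> g_dens n \<gamma> \<delta> m) at_top)
         \<and> density_on_moment_space n {0..} (g_dens n \<gamma> \<delta>)"
proof (intro conjI ballI)
  show "density_on_moment_space n {0..} (g_dens n \<gamma> \<delta>)"
    using assms by (intro g_dens_density) auto
  fix m
  show "((\<lambda>d. f_dens n d (\<gamma>d d) (\<delta>d d) m) \<longlongrightarrow> g_dens n \<gamma> \<delta> m) at_top"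
  proof (cases "\<forall>j\<in>{1..n}. moment_gap m j > 0")
    case True
    then show ?thesis using assms by (intro f_dens_tendsto_pos) auto
  next
    case False
    then obtain k where "k \<in> {1..n}" "gap_ratio m k \<le> 0" using first_nonpos_gap by blast
    then have "g_dens n \<gamma> \<delta> m = 0"
      unfolding g_dens_eq by (auto simp: gamma_kernel_def intro!: bexI[of _ k])
    then show ?thesis using f_dens_tendsto_zero[OF False] by simp
  qed
qed

end
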